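(* Let $\mu$ and $\nu$ be valuated matroids on $[n]$ of ranks $r\le s$. Then $\mu\twoheadleftarrow\nu$ if and only if $\overline{\operatorname{trop}}(\mu)\subseteq\overline{\operatorname{trop}}(\nu)$. Consequently, a sequence $(\mu_1,\dots,\mu_k)$ of valuated matroids on $[n]$ is a valuated flag matroid if and only if $\overline{\operatorname{trop}}(\mu_1)\subseteq\cdots\subseteq\overline{\operatorname{trop}}(\mu_k)$.
   Context: $\mathbb T=\mathbb R\cup\{\infty\}$. $\mathbb P(\mathbb T^{E})$ is $\mathbb T^E$ minus the all-$\infty$ vector modulo $u\sim u+c\mathbf 1$ ($c\in\mathbb R$); for nonempty $S\subseteq E$, $T_S$ denotes the classes with finite coordinates exactly at $S$, identified with $\mathbb R^S/\mathbb R\mathbf 1$. A valuated matroid of rank $r$ on a finite set $E$ is $\mu:\binom{E}{r}\to\mathbb T$ such that $\mathcal B(M)=\{I:\mu(I)\ne\infty\}$ is the set of bases of a matroid $M$ (underlying matroid) and for all $B,B'\in\mathcal B(M)$, $i\in B\setminus B'$ there is $j\in B'\setminus B$ with $\mu(B)+\mu(B')\ge\mu(B\setminus i\cup j)+\mu(B'\setminus j\cup i)$. For $S\subseteq E$ let $\mathcal B_S$ be the bases $B$ with $|B\cap S|$ maximal; the contraction $\mu/_S$ (on ground set $E\setminus S$, finite exactly on bases of $M/_S$) and restriction $\mu|_S$ (finite exactly on bases of $M|_S$) are the valuated matroids, unique up to additive constants, with $\mu(B)=\mu|_S(B\cap S)+\mu/_S(B\setminus S)$ for $B\in\mathcal B_S$.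 Valuated circuits: $\mathbf C_\mu(S)$, $S\in\binom{E}{r+1}$, with coordinates $\mu(S\setminus i)$ for $i\in S$ and $\infty$ otherwise, excluding all-$\infty$. $\operatorname{trop}(\mu)\subseteq\mathbb R^E/\mathbb R\mathbf 1$ is the set of $\bar u$ such that for each valuated circuit $\mathbf C$ the minimum of $\{C_i+u_i:C_i\ne\infty\}$ is attained at least twice. The projective tropical linear space is $\overline{\operatorname{trop}}(\mu)=\bigcup_{\emptyset\subseteq S\subsetneq[n]}\operatorname{trop}(\mu/_S)\times\{\infty\}^S\subseteq\mathbb P(\mathbb T^{[n]})$, with $\operatorname{trop}(\mu/_S)$ viewed in $T_{[n]\setminus S}$. For valuated matroids $\mu,\nu$ on $[n]$ of ranks $r\le s$ with underlying matroids $M,N$, $\mu\twoheadleftarrow\nu$ (valuated quotient) means: for all $I\in\mathcal B(M)$, $J\in\mathcal B(N)$, $i\in I\setminus J$ there is $j\in J\setminus I$ with $\mu(I)+\nu(J)\ge\mu(I\setminus i\cup j)+\nu(J\setminus j\cup i)$. A valuated flag matroid is a sequence $(\mu_1,\dots,\mu_k)$ with nondecreasing ranks and $\mu_i\twoheadleftarrow\mu_j$ for all $i<j$. *)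

theory Defs
  imports "HOL-Library.Extended_Real" "HOL-Library.FuncSet"
begin

text \<open>
  The tropical numbers \<open>\<real> \<union> {\<infinity>}\<close> are the extended reals different from \<open>-\<infinity>\<close>.
  A function on the \<open>r\<close>-subsets of \<open>E\<close> is a function on all sets whose other values are ignored.
\<close>

definition matroid_bases :: "'a set \<Rightarrow> 'a set set \<Rightarrow> bool" where
  "matroid_bases E \<B> \<longleftrightarrow> finite E \<and> \<B> \<noteq> {} \<and> \<B> \<subseteq> Pow E \<and>
     (\<forall>B\<in>\<B>. \<forall>B'\<in>\<B>. \<forall>i\<in>B - B'. \<exists>j\<in>B' - B. insert j (B - {i}) \<in> \<B>)"

definition bases :: "'a set \<Rightarrow> nat \<Rightarrow> ('a set \<Rightarrow> ereal) \<Rightarrow> 'a set set" where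
  "bases E r \<mu> = {I. I \<subseteq> E \<and> card I = r \<and> \<mu> I \<noteq> \<infinity>}"

definition valuated_matroid :: "'a set \<Rightarrow> nat \<Rightarrow> ('a set \<Rightarrow> ereal) \<Rightarrow> bool" where
  "valuated_matroid E r \<mu> \<longleftrightarrow>
     (\<forall>I. I \<subseteq> E \<and> card I = r \<longrightarrow> \<mu> I \<noteq> -\<infinity>) \<and>
     matroid_bases E (bases E r \<mu>) \<and>
     (\<forall>B\<in>bases E r \<mu>. \<forall>B'\<in>bases E r \<mu>. \<forall>i\<in>B - B'. \<exists>j\<in>B' - B.
        \<mu> B + \<mu> B' \<ge> \<mu> (insert j (B - {i})) + \<mu> (insert i (B' - {j})))"

definition max_bases :: "'a set \<Rightarrow> nat \<Rightarrow> ('a set \<Rightarrow> ereal) \<Rightarrow> 'a set \<Rightarrow> 'a set set" where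
  "max_bases E r \<mu> S =
     {B \<in> bases E r \<mu>. \<forall>B'\<in>bases E r \<mu>. card (B' \<inter> S) \<le> card (B \<inter> S)}"

definition matroid_rank :: "'a set \<Rightarrow> nat \<Rightarrow> ('a set \<Rightarrow> ereal) \<Rightarrow> 'a set \<Rightarrow> nat" where
  "matroid_rank E r \<mu> S = Max ((\<lambda>B. card (B \<inter> S)) ` bases E r \<mu>)"

text \<open>
  \<open>\<rho>\<close> is a restriction of \<open>\<mu>\<close> to \<open>S\<close> and \<open>\<kappa>\<close> a matching contraction of \<open>\<mu>\<close> by \<open>S\<close>; the bases
  of \<open>M|S\<close> and of \<open>M/S\<close> are the sets \<open>B \<inter> S\<close> and \<open>B - S\<close> for \<open>B \<in> max_bases E r \<mu> S\<close>.
\<close>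

definition is_restriction_contraction ::
    "'a set \<Rightarrow> nat \<Rightarrow> ('a set \<Rightarrow> ereal) \<Rightarrow> 'a set \<Rightarrow> ('a set \<Rightarrow> ereal) \<Rightarrow> ('a set \<Rightarrow> ereal) \<Rightarrow> bool"
  where
  "is_restriction_contraction E r \<mu> S \<rho> \<kappa> \<longleftrightarrow>
     (let q = matroid_rank E r \<mu> S in
        valuated_matroid S q \<rho> \<and>
        valuated_matroid (E - S) (r - q) \<kappa> \<and>
        bases S q \<rho> = (\<lambda>B. B \<inter> S) ` max_bases E r \<mu> S \<and>
        bases (E - S) (r - q) \<kappa> = (\<lambda>B. B - S) ` max_bases E r \<mu> S \<and>
        (\<forall>B\<in>max_bases E r \<mu> S. \<mu> B = \<rho> (B \<inter> S) + \<kappa> (B - S)))"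

text \<open>
  Contractions are only determined up to additive constants (\<open>contraction_exists\<close>,
  \<open>contraction_unique\<close> below), which do not affect tropical linear spaces; one is chosen.
\<close>

definition contraction ::
    "'a set \<Rightarrow> nat \<Rightarrow> ('a set \<Rightarrow> ereal) \<Rightarrow> 'a set \<Rightarrow> 'a set \<Rightarrow> ereal" where
  "contraction E r \<mu> S = (SOME \<kappa>. \<exists>\<rho>. is_restriction_contraction E r \<mu> S \<rho> \<kappa>)"

definition circuit_vector :: "'a set \<Rightarrow> ('a set \<Rightarrow> ereal) \<Rightarrow> 'a set \<Rightarrow> 'a \<Rightarrow> ereal" where
  "circuit_vector E \<mu> S = (\<lambda>i\<in>E. if i \<in> S then \<mu> (S - {i}) else \<infinity>)"

definition valuated_circuits :: "'a set \<Rightarrow> nat \<Rightarrow> ('a set \<Rightarrow> ereal) \<Rightarrow> ('a \<Rightarrow> ereal) set" where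
  "valuated_circuits E r \<mu> =
     circuit_vector E \<mu> ` {S. S \<subseteq> E \<and> card S = r + 1} - {\<lambda>i\<in>E. \<infinity>}"

definition min_attained_twice :: "'a set \<Rightarrow> ('a \<Rightarrow> ereal) \<Rightarrow> ('a \<Rightarrow> real) \<Rightarrow> bool" where
  "min_attained_twice E C u \<longleftrightarrow>
     (\<exists>i j. i \<noteq> j \<and>
        is_arg_min (\<lambda>k. C k + ereal (u k)) (\<lambda>k. k \<in> E \<and> C k \<noteq> \<infinity>) i \<and>
        is_arg_min (\<lambda>k. C k + ereal (u k)) (\<lambda>k. k \<in> E \<and> C k \<noteq> \<infinity>) j)"

definition real_torus :: "'a set \<Rightarrow> ('a \<Rightarrow> real) set set" where
  "real_torus E =
     (E \<rightarrow>\<^sub>E UNIV) // {(u, v). u \<in> E \<rightarrow>\<^sub>E UNIV \<and> (\<exists>c. v = (\<lambda>i\<in>E. u i + c))}"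

definition tropical_projective_space :: "'a set \<Rightarrow> ('a \<Rightarrow> ereal) set set" where
  "tropical_projective_space E =
     (let V = (E \<rightarrow>\<^sub>E {x. x \<noteq> -\<infinity>}) - {\<lambda>i\<in>E. \<infinity>}
      in V // {(u, v). u \<in> V \<and> (\<exists>c::real. v = (\<lambda>i\<in>E. u i + ereal c))})"

definition trop :: "'a set \<Rightarrow> nat \<Rightarrow> ('a set \<Rightarrow> ereal) \<Rightarrow> ('a \<Rightarrow> real) set set" where
  "trop E r \<mu> =
     {U \<in> real_torus E. \<forall>u\<in>U. \<forall>C\<in>valuated_circuits E r \<mu>. min_attained_twice E C u}"

text \<open>
  The identification of the torus on \<open>E - S\<close> with the stratum of the tropical projective space
  of \<open>E\<close> whose finite coordinates are exactly those in \<open>E - S\<close>.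
\<close>

definition stratum_embedding :: "'a set \<Rightarrow> 'a set \<Rightarrow> ('a \<Rightarrow> real) set \<Rightarrow> ('a \<Rightarrow> ereal) set" where
  "stratum_embedding E S U = (\<lambda>u. \<lambda>i\<in>E. if i \<in> S then \<infinity> else ereal (u i)) ` U"

definition projective_trop :: "'a set \<Rightarrow> nat \<Rightarrow> ('a set \<Rightarrow> ereal) \<Rightarrow> ('a \<Rightarrow> ereal) set set" where
  "projective_trop E r \<mu> =
     (\<Union>S\<in>{S. S \<subset> E}. stratum_embedding E S `
        trop (E - S) (r - matroid_rank E r \<mu> S) (contraction E r \<mu> S))"

definition valuated_quotient ::
    "'a set \<Rightarrow> nat \<Rightarrow> ('a set \<Rightarrow> ereal) \<Rightarrow> nat \<Rightarrow> ('a set \<Rightarrow> ereal) \<Rightarrow> bool" where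
  "valuated_quotient E r \<mu> s \<nu> \<longleftrightarrow>
     (\<forall>I\<in>bases E r \<mu>. \<forall>J\<in>bases E s \<nu>. \<forall>i\<in>I - J. \<exists>j\<in>J - I.
        \<mu> I + \<nu> J \<ge> \<mu> (insert j (I - {i})) + \<nu> (insert i (J - {j})))"

definition valuated_flag_matroid ::
    "'a set \<Rightarrow> nat \<Rightarrow> (nat \<Rightarrow> nat) \<Rightarrow> (nat \<Rightarrow> 'a set \<Rightarrow> ereal) \<Rightarrow> bool" where
  "valuated_flag_matroid E k r \<mu> \<longleftrightarrow>
     (\<forall>i\<in>{1..k}. valuated_matroid E (r i) (\<mu> i)) \<and>
     (\<forall>i\<in>{1..k}. \<forall>j\<in>{1..k}. i < j \<longrightarrow>
        r i \<le> r j \<and> valuated_quotient E (r i) (\<mu> i) (r j) (\<mu> j))"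

lemma projective_trop_subset:
  "projective_trop E r \<mu> \<subseteq> tropical_projective_space E"
proof
  fix X assume "X \<in> projective_trop E r \<mu>"
  then obtain S U where S: "S \<subset> E" and U: "U \<in> real_torus (E - S)"
    and X: "X = stratum_embedding E S U"
    unfolding projective_trop_def trop_def by blast
  from U obtain u where u: "U = {\<lambda>i\<in>E - S. u i + c | c. True}"
    and uE: "u \<in> (E - S) \<rightarrow>\<^sub>E UNIV"
    unfolding real_torus_def quotient_def by blast
  define w where "w = (\<lambda>i\<in>E. if i \<in> S then \<infinity> else ereal (u i))"
  obtain e where e: "e \<in> E" "e \<notin> S" using S by blast
  have "w e \<noteq> (\<lambda>i\<in>E. \<infinity>) e" using e by (simp add: w_def)
  then have ne: "w \<noteq> (\<lambda>i\<in>E. \<infinity>)" by metis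
  have wV: "w \<in> (E \<rightarrow>\<^sub>E {x. x \<noteq> -\<infinity>}) - {\<lambda>i\<in>E. \<infinity>}"
    using ne by (auto simp: w_def)
  have eq: "(\<lambda>i\<in>E. if i \<in> S then \<infinity> else ereal ((\<lambda>i\<in>E - S. u i + c) i)) = (\<lambda>i\<in>E. w i + ereal c)"
    for c by (auto simp: w_def fun_eq_iff)
  have "X = {\<lambda>i\<in>E. w i + ereal c | c. True}"
    unfolding X stratum_embedding_def u using eq by (auto simp: image_iff) metis+
  then show "X \<in> tropical_projective_space E"
    unfolding tropical_projective_space_def Let_def quotient_def using wV by blast
qed

lemma max_bases_exchange:
  assumes vm: "valuated_matroid E r \<mu>" and S: "S \<subseteq> E"
    and B: "B \<in> max_bases E r \<mu> S" and B': "B' \<in> max_bases E r \<mu> S"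
    and i: "i \<in> B - B'"
  obtains j where "j \<in> B' - B" "j \<in> S \<longleftrightarrow> i \<in> S"
    "insert j (B - {i}) \<in> max_bases E r \<mu> S" "insert i (B' - {j}) \<in> max_bases E r \<mu> S"
    "\<mu> B + \<mu> B' \<ge> \<mu> (insert j (B - {i})) + \<mu> (insert i (B' - {j}))"
proof -
  have fE: "finite E" using vm unfolding valuated_matroid_def matroid_bases_def by blast
  have bB: "B \<in> bases E r \<mu>" "B' \<in> bases E r \<mu>" using B B' by (auto simp: max_bases_def)
  then obtain j where j: "j \<in> B' - B"
    and le: "\<mu> B + \<mu> B' \<ge> \<mu> (insert j (B - {i})) + \<mu> (insert i (B' - {j}))"
    using vm i unfolding valuated_matroid_def by blast
  have fB: "finite B" "finite B'" using bB fE by (auto simp: bases_def intro: finite_subset)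
  define B1 B2 where "B1 = insert j (B - {i})" and "B2 = insert i (B' - {j})"
  have sub: "B1 \<subseteq> E" "B2 \<subseteq> E" using bB i j by (auto simp: B1_def B2_def bases_def)
  have c1: "card B1 = Suc (card B - 1)" "card B2 = Suc (card B' - 1)"
    using i j fB by (simp_all add: B1_def B2_def)
  have "card B > 0" "card B' > 0" using i j fB by (auto simp: card_gt_0_iff)
  with c1 have crd: "card B1 = r" "card B2 = r" using bB by (auto simp: bases_def)
  have nm: "\<mu> B1 \<noteq> -\<infinity>" "\<mu> B2 \<noteq> -\<infinity>"
    using vm sub crd unfolding valuated_matroid_def by blast+
  have "\<mu> B \<noteq> \<infinity>" "\<mu> B' \<noteq> \<infinity>" using bB by (auto simp: bases_def)
  then have "\<mu> B + \<mu> B' \<noteq> \<infinity>" by simp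
  then have "\<mu> B1 + \<mu> B2 \<noteq> \<infinity>" using le by (auto simp: B1_def B2_def)
  then have bb: "B1 \<in> bases E r \<mu>" "B2 \<in> bases E r \<mu>"
    using sub crd nm by (auto simp: bases_def)
  have eqc: "card (B \<inter> S) = card (B' \<inter> S)"
    using B B' bB by (auto simp: max_bases_def intro: antisym)
  have l1: "card (B1 \<inter> S) \<le> card (B \<inter> S)" "card (B2 \<inter> S) \<le> card (B \<inter> S)"
    using B bb by (auto simp: max_bases_def)
  have k1: "card (B1 \<inter> S) + (if i \<in> S then 1 else 0) = card (B \<inter> S) + (if j \<in> S then 1 else 0)"
  proof -
    have "B1 \<inter> S = (if j \<in> S then insert j ((B \<inter> S) - {i}) else (B \<inter> S) - {i})"
      by (auto simp: B1_def)
    moreover have "card ((B \<inter> S) - {i}) + (if i \<in> S then 1 else 0) = card (B \<inter> S)"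
    proof (cases "i \<in> S")
      case True
      then have "i \<in> B \<inter> S" using i by blast
      then show ?thesis using True fB card_Suc_Diff1[of "B \<inter> S" i] by simp
    qed simp
    moreover have "j \<notin> (B \<inter> S) - {i}" using j by blast
    ultimately show ?thesis using fB by (auto split: if_splits)
  qed
  have k2: "card (B2 \<inter> S) + (if j \<in> S then 1 else 0) = card (B' \<inter> S) + (if i \<in> S then 1 else 0)"
  proof -
    have "B2 \<inter> S = (if i \<in> S then insert i ((B' \<inter> S) - {j}) else (B' \<inter> S) - {j})"
      by (auto simp: B2_def)
    moreover have "card ((B' \<inter> S) - {j}) + (if j \<in> S then 1 else 0) = card (B' \<inter> S)"
    proof (cases "j \<in> S")
      case True
      then have "j \<in> B' \<inter> S" using j by blast
      then show ?thesis using True fB card_Suc_Diff1[of "B' \<inter> S" j] by simp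
    qed simp
    moreover have "i \<notin> (B' \<inter> S) - {j}" using i by blast
    ultimately show ?thesis using fB by (auto split: if_splits)
  qed
  have ij: "j \<in> S \<longleftrightarrow> i \<in> S" using k1 k2 l1 eqc by (auto split: if_splits)
  then have "card (B1 \<inter> S) = card (B \<inter> S)" "card (B2 \<inter> S) = card (B \<inter> S)"
    using k1 k2 eqc by auto
  then have "B1 \<in> max_bases E r \<mu> S" "B2 \<in> max_bases E r \<mu> S"
    using bb B by (auto simp: max_bases_def)
  with that j ij le show ?thesis by (auto simp: B1_def B2_def)
qed

lemma max_bases_finite_value:
  assumes "valuated_matroid E r \<mu>" "B \<in> max_bases E r \<mu> S"
  shows "\<bar>\<mu> B\<bar> \<noteq> \<infinity>"
  using assms unfolding valuated_matroid_def max_bases_def bases_def by auto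

lemma max_bases_product_aux:
  assumes vm: "valuated_matroid E r \<mu>" and S: "S \<subseteq> E"
    and sub: "A \<subseteq> S" "A' \<subseteq> S" "J \<inter> S = {}" "J' \<inter> S = {}"
    and B: "A \<union> J \<in> max_bases E r \<mu> S" and B': "A' \<union> J' \<in> max_bases E r \<mu> S"
  shows "A' \<union> J \<in> max_bases E r \<mu> S"
  using sub B
proof (induction "card (A - A')" arbitrary: A)
  case 0
  have fE: "finite E" using vm unfolding valuated_matroid_def matroid_bases_def by blast
  then have fS: "finite S" using S finite_subset by blast
  have "A \<subseteq> A'" using 0 fS by (metis Diff_eq_empty_iff card_0_eq finite_Diff finite_subset)
  moreover have "card A = card A'"
  proof -
    have "card ((A \<union> J) \<inter> S) = card ((A' \<union> J') \<inter> S)"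
      using 0 B' by (auto simp: max_bases_def intro: antisym)
    moreover have "(A \<union> J) \<inter> S = A" "(A' \<union> J') \<inter> S = A'" using 0 sub by auto
    ultimately show ?thesis by simp
  qed
  ultimately have "A = A'" using fS sub by (metis card_subset_eq finite_subset)
  with 0 show ?case by simp
next
  case (Suc n)
  then obtain i where i: "i \<in> A - A'" by (metis card.empty ex_in_conv nat.distinct(1))
  have iS: "i \<in> S" "i \<in> (A \<union> J) - (A' \<union> J')" using i Suc.prems by auto
  obtain j where j: "j \<in> (A' \<union> J') - (A \<union> J)" "j \<in> S \<longleftrightarrow> i \<in> S"
    and m: "insert j ((A \<union> J) - {i}) \<in> max_bases E r \<mu> S"
    using max_bases_exchange[OF vm S Suc.prems(5) B' iS(2)] by metis
  have jA: "j \<in> A' - A" using j iS Suc.prems by auto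
  have eq: "insert j ((A \<union> J) - {i}) = insert j (A - {i}) \<union> J" using iS Suc.prems by auto
  have "insert j (A - {i}) - A' = (A - A') - {i}" using jA by auto
  moreover have "finite (A - A')" using Suc.hyps(2) card.infinite by force
  ultimately have "n = card (insert j (A - {i}) - A')" using Suc.hyps(2) i by simp
  moreover have "insert j (A - {i}) \<subseteq> S" using jA Suc.prems by auto
  ultimately show ?case using Suc.hyps(1)[of "insert j (A - {i})"] Suc.prems m eq by simp
qed

lemma max_bases_product:
  assumes vm: "valuated_matroid E r \<mu>" and S: "S \<subseteq> E"
    and B: "B \<in> max_bases E r \<mu> S" and B': "B' \<in> max_bases E r \<mu> S"
  shows "(B' \<inter> S) \<union> (B - S) \<in> max_bases E r \<mu> S"
  by (rule max_bases_product_aux[OF vm S, of "B \<inter> S" _ _ "B' - S"])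
     (use B B' in \<open>auto simp: Un_commute Int_Diff_Un Un_Diff_Int\<close>)

lemma max_bases_additive:
  assumes vm: "valuated_matroid E r \<mu>" and S: "S \<subseteq> E"
    and sub: "A \<subseteq> S" "A' \<subseteq> S" "J \<inter> S = {}" "J' \<inter> S = {}"
    and B: "A \<union> J \<in> max_bases E r \<mu> S" and B': "A' \<union> J' \<in> max_bases E r \<mu> S"
  shows "\<mu> (A \<union> J) + \<mu> (A' \<union> J') = \<mu> (A' \<union> J) + \<mu> (A \<union> J')"
  using sub B
proof (induction "card (A - A')" arbitrary: A)
  case 0
  have fE: "finite E" using vm unfolding valuated_matroid_def matroid_bases_def by blast
  then have fS: "finite S" using S finite_subset by blast
  have "A \<subseteq> A'" using 0 fS by (metis Diff_eq_empty_iff card_0_eq finite_Diff finite_subset)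
  moreover have "card A = card A'"
  proof -
    have "card ((A \<union> J) \<inter> S) = card ((A' \<union> J') \<inter> S)"
      using 0 B' by (auto simp: max_bases_def intro: antisym)
    moreover have "(A \<union> J) \<inter> S = A" "(A' \<union> J') \<inter> S = A'" using 0 sub by auto
    ultimately show ?thesis by simp
  qed
  ultimately have "A = A'" using fS sub by (metis card_subset_eq finite_subset)
  then show ?case by simp
next
  case (Suc n)
  note mb = max_bases_product_aux[OF vm S]
  then obtain i where i: "i \<in> A - A'"
    using Suc.hyps(2) by (metis card.empty ex_in_conv nat.distinct(1))
  have iS: "i \<in> S" "i \<in> (A \<union> J) - (A' \<union> J')" using i Suc.prems by auto
  obtain j where j: "j \<in> (A' \<union> J') - (A \<union> J)" "j \<in> S \<longleftrightarrow> i \<in> S"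
    and m: "insert j ((A \<union> J) - {i}) \<in> max_bases E r \<mu> S"
    using max_bases_exchange[OF vm S Suc.prems(5) B' iS(2)] by metis
  have jA: "j \<in> A' - A" using j iS Suc.prems by auto
  define A1 where "A1 = insert j (A - {i})"
  have A1S: "A1 \<subseteq> S" using jA Suc.prems by (auto simp: A1_def)
  have eq: "insert j ((A \<union> J) - {i}) = A1 \<union> J" using iS Suc.prems by (auto simp: A1_def)
  have m1: "A1 \<union> J \<in> max_bases E r \<mu> S" using m eq by simp
  have m1': "A1 \<union> J' \<in> max_bases E r \<mu> S" by (rule mb[OF sub(2) A1S sub(4,3) B' m1])
  have m0': "A \<union> J' \<in> max_bases E r \<mu> S"
    by (rule mb[OF sub(2) Suc.prems(1) sub(4,3) B' Suc.prems(5)])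
  have m2: "A' \<union> J \<in> max_bases E r \<mu> S"
    by (rule mb[OF Suc.prems(1) sub(2,3,4) Suc.prems(5) B'])
  have step: "\<mu> (A \<union> K) + \<mu> (A1 \<union> K') \<ge> \<mu> (A1 \<union> K) + \<mu> (A \<union> K')"
    if K: "K \<inter> S = {}" "K' \<inter> S = {}"
      and h: "A \<union> K \<in> max_bases E r \<mu> S" "A1 \<union> K' \<in> max_bases E r \<mu> S" for K K'
  proof -
    have "i \<in> (A \<union> K) - (A1 \<union> K')" using i jA K iS by (auto simp: A1_def)
    then obtain l where l: "l \<in> (A1 \<union> K') - (A \<union> K)" "l \<in> S \<longleftrightarrow> i \<in> S"
      and le: "\<mu> (A \<union> K) + \<mu> (A1 \<union> K')
                 \<ge> \<mu> (insert l ((A \<union> K) - {i})) + \<mu> (insert i ((A1 \<union> K') - {l}))"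
      using max_bases_exchange[OF vm S h] by metis
    have "l = j" using l iS K by (auto simp: A1_def)
    moreover have "insert j ((A \<union> K) - {i}) = A1 \<union> K" using iS K by (auto simp: A1_def)
    moreover have "insert i ((A1 \<union> K') - {j}) = A \<union> K'"
      using i jA K A1S by (auto simp: A1_def)
    ultimately show ?thesis using le by simp
  qed
  have e1: "\<mu> (A \<union> J) + \<mu> (A1 \<union> J') = \<mu> (A1 \<union> J) + \<mu> (A \<union> J')"
    using step[OF sub(3,4) Suc.prems(5) m1'] step[OF sub(4,3) m0' m1]
    by (simp add: add.commute antisym)
  have "A1 - A' = (A - A') - {i}" using jA by (auto simp: A1_def)
  moreover have "finite (A - A')" using Suc.hyps(2) card.infinite by force
  ultimately have "n = card (A1 - A')" using Suc.hyps(2) i by simp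
  then have e2: "\<mu> (A1 \<union> J) + \<mu> (A' \<union> J') = \<mu> (A' \<union> J) + \<mu> (A1 \<union> J')"
    using Suc.hyps(1) A1S Suc.prems m1 by auto
  have r: "\<exists>x. \<mu> X = ereal x" if "X \<in> max_bases E r \<mu> S" for X
    using max_bases_finite_value[OF vm that] by (cases "\<mu> X") auto
  obtain a b c d e f where "\<mu> (A \<union> J) = ereal a" "\<mu> (A' \<union> J') = ereal b"
      "\<mu> (A1 \<union> J) = ereal c" "\<mu> (A1 \<union> J') = ereal d"
      "\<mu> (A \<union> J') = ereal e" "\<mu> (A' \<union> J) = ereal f"
    using r[OF Suc.prems(5)] r[OF B'] r[OF m1] r[OF m1'] r[OF m0'] r[OF m2] by blast
  then show ?case using e1 e2 by simp
qed

lemma max_bases_nonempty: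
  assumes vm: "valuated_matroid E r \<mu>"
  shows "\<exists>B. B \<in> max_bases E r \<mu> S"
proof -
  have fE: "finite E" and ne: "bases E r \<mu> \<noteq> {}" and sub: "bases E r \<mu> \<subseteq> Pow E"
    using vm unfolding valuated_matroid_def matroid_bases_def by blast+
  have fin: "finite ((\<lambda>B. card (B \<inter> S)) ` bases E r \<mu>)"
    using fE sub by (meson finite_Pow_iff finite_imageI finite_subset)
  with ne have "Max ((\<lambda>B. card (B \<inter> S)) ` bases E r \<mu>) \<in> (\<lambda>B. card (B \<inter> S)) ` bases E r \<mu>"
    by (intro Max_in) auto
  then obtain B where B: "B \<in> bases E r \<mu>"
    "card (B \<inter> S) = Max ((\<lambda>B. card (B \<inter> S)) ` bases E r \<mu>)" by (elim imageE) simp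
  have "card (B' \<inter> S) \<le> card (B \<inter> S)" if "B' \<in> bases E r \<mu>" for B'
    unfolding B(2) using fin that by (intro Max_ge) auto
  with B(1) show ?thesis by (auto simp: max_bases_def)
qed

lemma matroid_rank_eq:
  assumes vm: "valuated_matroid E r \<mu>" and B: "B \<in> max_bases E r \<mu> S"
  shows "matroid_rank E r \<mu> S = card (B \<inter> S)"
proof -
  have "finite E" "bases E r \<mu> \<subseteq> Pow E"
    using vm unfolding valuated_matroid_def matroid_bases_def by blast+
  then have "finite ((\<lambda>B. card (B \<inter> S)) ` bases E r \<mu>)"
    by (meson finite_Pow_iff finite_imageI finite_subset)
  then show ?thesis
    unfolding matroid_rank_def using B by (intro Max_eqI) (auto simp: max_bases_def)
qed

lemma valuated_matroidI:
  assumes "finite E" and "\<And>I. I \<subseteq> E \<Longrightarrow> card I = r \<Longrightarrow> \<mu> I \<noteq> -\<infinity>" and "bases E r \<mu> \<noteq> {}"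
    and ex: "\<And>B B' i. B \<in> bases E r \<mu> \<Longrightarrow> B' \<in> bases E r \<mu> \<Longrightarrow> i \<in> B - B' \<Longrightarrow>
      \<exists>j\<in>B' - B. insert j (B - {i}) \<in> bases E r \<mu> \<and>
        \<mu> B + \<mu> B' \<ge> \<mu> (insert j (B - {i})) + \<mu> (insert i (B' - {j}))"
  shows "valuated_matroid E r \<mu>"
proof -
  have "bases E r \<mu> \<subseteq> Pow E" by (auto simp: bases_def)
  then have "matroid_bases E (bases E r \<mu>)"
    unfolding matroid_bases_def using assms(1,3) ex by blast
  then show ?thesis unfolding valuated_matroid_def using assms(2) ex by blast
qed

lemma contraction_exists:
  assumes vm: "valuated_matroid E r \<mu>" and S: "S \<subseteq> E"
  shows "\<exists>\<rho> \<kappa>. is_restriction_contraction E r \<mu> S \<rho> \<kappa>"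
proof -
  obtain B0 where B0: "B0 \<in> max_bases E r \<mu> S" using max_bases_nonempty[OF vm] by blast
  define A0 J0 q where "A0 = B0 \<inter> S" and "J0 = B0 - S" and "q = matroid_rank E r \<mu> S"
  have fE: "finite E" using vm unfolding valuated_matroid_def matroid_bases_def by blast
  have fS: "finite S" using fE S finite_subset by blast
  have B0E: "B0 \<subseteq> E" "card B0 = r" using B0 by (auto simp: max_bases_def bases_def)
  have fB0: "finite B0" using B0E fE finite_subset by blast
  have B0eq: "B0 = A0 \<union> J0" by (auto simp: A0_def J0_def)
  have A0: "A0 \<subseteq> S" "finite A0" and J0: "J0 \<inter> S = {}" "J0 \<subseteq> E" "finite J0"
    using fB0 B0E by (auto simp: A0_def J0_def)
  have q: "q = card A0" using matroid_rank_eq[OF vm B0] by (simp add: q_def A0_def)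
  have "card B0 = card A0 + card J0" unfolding B0eq using A0 J0 by (intro card_Un_disjoint) auto
  then have r: "r = q + card J0" using q B0E by simp
  have rank: "card (B \<inter> S) = q" if "B \<in> max_bases E r \<mu> S" for B
    using matroid_rank_eq[OF vm that] by (simp add: q_def)
  have max: "B \<in> max_bases E r \<mu> S" if "B \<subseteq> E" "card B = r" "\<mu> B \<noteq> \<infinity>" "card (B \<inter> S) = q" for B
    using that B0 q by (auto simp: max_bases_def bases_def A0_def)
  obtain m where m: "\<mu> B0 = ereal m"
    using max_bases_finite_value[OF vm B0] by (cases "\<mu> B0") auto
  define \<rho> \<kappa> where "\<rho> = (\<lambda>A. \<mu> (A \<union> J0))" and "\<kappa> = (\<lambda>J. \<mu> (A0 \<union> J) + ereal (- m))"
  have cA: "A \<union> J0 \<subseteq> E \<and> card (A \<union> J0) = r \<and> (A \<union> J0) \<inter> S = A" if "A \<subseteq> S" "card A = q" for A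
  proof -
    have "card (A \<union> J0) = card A + card J0"
      using that J0 fS by (intro card_Un_disjoint) (auto intro: finite_subset)
    then show ?thesis using that J0 S r by auto
  qed
  have cJ: "A0 \<union> J \<subseteq> E \<and> card (A0 \<union> J) = r \<and> (A0 \<union> J) \<inter> S = A0 \<and> (A0 \<union> J) - S = J"
    if "J \<subseteq> E - S" "card J = r - q" for J
  proof -
    have "card (A0 \<union> J) = card A0 + card J"
      using that A0 fE by (intro card_Un_disjoint) (auto intro: finite_subset)
    then show ?thesis using that A0 S r q by auto
  qed
  have b\<rho>: "A \<in> bases S q \<rho> \<longleftrightarrow> A \<subseteq> S \<and> A \<union> J0 \<in> max_bases E r \<mu> S" for A
  proof
    assume "A \<in> bases S q \<rho>"
    then have h: "A \<subseteq> S" "card A = q" "\<mu> (A \<union> J0) \<noteq> \<infinity>" by (auto simp: bases_def \<rho>_def)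
    then show "A \<subseteq> S \<and> A \<union> J0 \<in> max_bases E r \<mu> S" using max cA[OF h(1,2)] by auto
  next
    assume h: "A \<subseteq> S \<and> A \<union> J0 \<in> max_bases E r \<mu> S"
    moreover have "(A \<union> J0) \<inter> S = A" using h J0 by auto
    ultimately have "card A = q" using rank by metis
    then show "A \<in> bases S q \<rho>" using h by (auto simp: bases_def \<rho>_def max_bases_def)
  qed
  have b\<kappa>: "J \<in> bases (E - S) (r - q) \<kappa> \<longleftrightarrow> J \<inter> S = {} \<and> A0 \<union> J \<in> max_bases E r \<mu> S" for J
  proof
    assume "J \<in> bases (E - S) (r - q) \<kappa>"
    then have h: "J \<subseteq> E - S" "card J = r - q" "\<mu> (A0 \<union> J) \<noteq> \<infinity>"
      by (auto simp: bases_def \<kappa>_def)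
    then show "J \<inter> S = {} \<and> A0 \<union> J \<in> max_bases E r \<mu> S" using max cJ[OF h(1,2)] q by auto
  next
    assume h: "J \<inter> S = {} \<and> A0 \<union> J \<in> max_bases E r \<mu> S"
    then have JE: "A0 \<union> J \<subseteq> E" "card (A0 \<union> J) = r" "\<mu> (A0 \<union> J) \<noteq> \<infinity>"
      by (auto simp: max_bases_def bases_def)
    have "card (A0 \<union> J) = card A0 + card J"
      using A0 fE JE h by (intro card_Un_disjoint) (auto intro: finite_subset)
    then have "card J = r - q" using JE q by simp
    then show "J \<in> bases (E - S) (r - q) \<kappa>" using h JE by (auto simp: bases_def \<kappa>_def)
  qed
  have "bases S q \<rho> = (\<lambda>B. B \<inter> S) ` max_bases E r \<mu> S"
  proof (intro set_eqI iffI)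
    fix A assume "A \<in> bases S q \<rho>"
    then have "A \<subseteq> S" "A \<union> J0 \<in> max_bases E r \<mu> S" using b\<rho> by auto
    moreover from this have "A = (A \<union> J0) \<inter> S" using J0 by auto
    ultimately show "A \<in> (\<lambda>B. B \<inter> S) ` max_bases E r \<mu> S" by blast
  next
    fix A assume "A \<in> (\<lambda>B. B \<inter> S) ` max_bases E r \<mu> S"
    then obtain B where B: "B \<in> max_bases E r \<mu> S" "A = B \<inter> S" by blast
    show "A \<in> bases S q \<rho>"
      using max_bases_product[OF vm S B0 B(1)] B(2) b\<rho> by (auto simp: J0_def)
  qed
  moreover have "bases (E - S) (r - q) \<kappa> = (\<lambda>B. B - S) ` max_bases E r \<mu> S"
  proof (intro set_eqI iffI)
    fix J assume "J \<in> bases (E - S) (r - q) \<kappa>"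
    then have "J \<inter> S = {}" "A0 \<union> J \<in> max_bases E r \<mu> S" using b\<kappa> by auto
    moreover from this have "J = (A0 \<union> J) - S" using A0 by auto
    ultimately show "J \<in> (\<lambda>B. B - S) ` max_bases E r \<mu> S" by blast
  next
    fix J assume "J \<in> (\<lambda>B. B - S) ` max_bases E r \<mu> S"
    then obtain B where B: "B \<in> max_bases E r \<mu> S" "J = B - S" by blast
    show "J \<in> bases (E - S) (r - q) \<kappa>"
      using max_bases_product[OF vm S B(1) B0] B(2) b\<kappa> by (auto simp: A0_def)
  qed
  moreover have "\<mu> B = \<rho> (B \<inter> S) + \<kappa> (B - S)" if B: "B \<in> max_bases E r \<mu> S" for B
  proof -
    have Beq: "(B \<inter> S) \<union> (B - S) = B" by auto
    have "\<mu> ((B \<inter> S) \<union> (B - S)) + \<mu> (A0 \<union> J0) = \<mu> (A0 \<union> (B - S)) + \<mu> ((B \<inter> S) \<union> J0)"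
      by (rule max_bases_additive[OF vm S]) (use B B0 A0 J0 B0eq Beq in auto)
    then have eq: "\<mu> B + ereal m = \<mu> (A0 \<union> (B - S)) + \<mu> ((B \<inter> S) \<union> J0)"
      using Beq B0eq m by simp
    obtain b where "\<mu> B = ereal b"
      using max_bases_finite_value[OF vm B] by (cases "\<mu> B") auto
    with eq show ?thesis unfolding \<rho>_def \<kappa>_def
      by (cases "\<mu> (A0 \<union> (B - S))"; cases "\<mu> ((B \<inter> S) \<union> J0)") auto
  qed
  moreover have "valuated_matroid S q \<rho>"
  proof (rule valuated_matroidI)
    show "\<rho> I \<noteq> -\<infinity>" if "I \<subseteq> S" "card I = q" for I
      using vm cA[OF that] unfolding \<rho>_def valuated_matroid_def by blast
    show "bases S q \<rho> \<noteq> {}" using b\<rho>[of A0] B0 B0eq A0 by auto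
    fix A A' i assume h: "A \<in> bases S q \<rho>" "A' \<in> bases S q \<rho>" "i \<in> A - A'"
    then have AS: "A \<subseteq> S" "A' \<subseteq> S" "A \<union> J0 \<in> max_bases E r \<mu> S" "A' \<union> J0 \<in> max_bases E r \<mu> S"
      using b\<rho> by auto
    have i: "i \<in> (A \<union> J0) - (A' \<union> J0)" using h AS J0 by auto
    obtain j where j: "j \<in> (A' \<union> J0) - (A \<union> J0)"
      "insert j ((A \<union> J0) - {i}) \<in> max_bases E r \<mu> S"
      "\<mu> (A \<union> J0) + \<mu> (A' \<union> J0)
        \<ge> \<mu> (insert j ((A \<union> J0) - {i})) + \<mu> (insert i ((A' \<union> J0) - {j}))"
      by (rule max_bases_exchange[OF vm S AS(3,4) i])
    have e: "insert j ((A \<union> J0) - {i}) = insert j (A - {i}) \<union> J0"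
      "insert i ((A' \<union> J0) - {j}) = insert i (A' - {j}) \<union> J0" using i j by auto
    show "\<exists>j\<in>A' - A. insert j (A - {i}) \<in> bases S q \<rho> \<and>
        \<rho> A + \<rho> A' \<ge> \<rho> (insert j (A - {i})) + \<rho> (insert i (A' - {j}))"
    proof (intro bexI conjI)
      show "j \<in> A' - A" using j by auto
      then have "insert j (A - {i}) \<subseteq> S" using AS by auto
      then show "insert j (A - {i}) \<in> bases S q \<rho>" using b\<rho> j(2) e(1) by simp
      show "\<rho> A + \<rho> A' \<ge> \<rho> (insert j (A - {i})) + \<rho> (insert i (A' - {j}))"
        using j(3) unfolding \<rho>_def e .
    qed
  qed (rule fS)
  moreover have "valuated_matroid (E - S) (r - q) \<kappa>"
  proof (rule valuated_matroidI)
    show "\<kappa> I \<noteq> -\<infinity>" if "I \<subseteq> E - S" "card I = r - q" for I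
    proof -
      have "\<mu> (A0 \<union> I) \<noteq> -\<infinity>" using vm cJ[OF that] unfolding valuated_matroid_def by blast
      then show ?thesis by (simp add: \<kappa>_def)
    qed
    show "bases (E - S) (r - q) \<kappa> \<noteq> {}" using b\<kappa>[of J0] B0 B0eq J0 by auto
    fix J J' i assume h: "J \<in> bases (E - S) (r - q) \<kappa>" "J' \<in> bases (E - S) (r - q) \<kappa>" "i \<in> J - J'"
    then have JS: "J \<inter> S = {}" "J' \<inter> S = {}"
      "A0 \<union> J \<in> max_bases E r \<mu> S" "A0 \<union> J' \<in> max_bases E r \<mu> S"
      using b\<kappa> by auto
    have i: "i \<in> (A0 \<union> J) - (A0 \<union> J')" using h JS A0 by auto
    obtain j where j: "j \<in> (A0 \<union> J') - (A0 \<union> J)"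
      "insert j ((A0 \<union> J) - {i}) \<in> max_bases E r \<mu> S"
      "\<mu> (A0 \<union> J) + \<mu> (A0 \<union> J')
        \<ge> \<mu> (insert j ((A0 \<union> J) - {i})) + \<mu> (insert i ((A0 \<union> J') - {j}))"
      by (rule max_bases_exchange[OF vm S JS(3,4) i])
    have e: "insert j ((A0 \<union> J) - {i}) = A0 \<union> insert j (J - {i})"
      "insert i ((A0 \<union> J') - {j}) = A0 \<union> insert i (J' - {j})" using i j by auto
    show "\<exists>j\<in>J' - J. insert j (J - {i}) \<in> bases (E - S) (r - q) \<kappa> \<and>
        \<kappa> J + \<kappa> J' \<ge> \<kappa> (insert j (J - {i})) + \<kappa> (insert i (J' - {j}))"
    proof (intro bexI conjI)
      show "j \<in> J' - J" using j by auto
      then have "insert j (J - {i}) \<inter> S = {}" using JS by auto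
      then show "insert j (J - {i}) \<in> bases (E - S) (r - q) \<kappa>" using b\<kappa> j(2) e(1) by simp
      have "\<kappa> (insert j (J - {i})) + \<kappa> (insert i (J' - {j})) =
          \<mu> (A0 \<union> insert j (J - {i})) + \<mu> (A0 \<union> insert i (J' - {j})) + (ereal (- m) + ereal (- m))"
        unfolding \<kappa>_def by (simp only: ac_simps)
      also have "\<dots> \<le> \<mu> (A0 \<union> J) + \<mu> (A0 \<union> J') + (ereal (- m) + ereal (- m))"
        using j(3) unfolding e by (rule add_right_mono)
      also have "\<dots> = \<kappa> J + \<kappa> J'" unfolding \<kappa>_def by (simp only: ac_simps)
      finally show "\<kappa> J + \<kappa> J' \<ge> \<kappa> (insert j (J - {i})) + \<kappa> (insert i (J' - {j}))" .
    qed
  qed (use fE in simp)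
  ultimately have "is_restriction_contraction E r \<mu> S \<rho> \<kappa>"
    unfolding is_restriction_contraction_def Let_def q_def by blast
  then show ?thesis by blast
qed

lemma contraction_unique:
  assumes vm: "valuated_matroid E r \<mu>" and S: "S \<subseteq> E"
    and c1: "is_restriction_contraction E r \<mu> S \<rho> \<kappa>"
    and c2: "is_restriction_contraction E r \<mu> S \<rho>' \<kappa>'"
  shows "\<exists>c::real. \<forall>J. J \<subseteq> E - S \<and> card J = r - matroid_rank E r \<mu> S \<longrightarrow> \<kappa>' J = \<kappa> J + ereal c"
proof -
  obtain B0 where B0: "B0 \<in> max_bases E r \<mu> S" using max_bases_nonempty[OF vm] by blast
  define A0 q where "A0 = B0 \<inter> S" and "q = matroid_rank E r \<mu> S"
  have b: "bases (E - S) (r - q) \<kappa> = (\<lambda>B. B - S) ` max_bases E r \<mu> S"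
    "bases (E - S) (r - q) \<kappa>' = (\<lambda>B. B - S) ` max_bases E r \<mu> S"
    and v: "\<And>B. B \<in> max_bases E r \<mu> S \<Longrightarrow> \<mu> B = \<rho> (B \<inter> S) + \<kappa> (B - S)"
    "\<And>B. B \<in> max_bases E r \<mu> S \<Longrightarrow> \<mu> B = \<rho>' (B \<inter> S) + \<kappa>' (B - S)"
    using c1 c2 unfolding is_restriction_contraction_def Let_def q_def by simp_all
  have fin: "\<bar>\<mu> B0\<bar> \<noteq> \<infinity>" by (rule max_bases_finite_value[OF vm B0])
  have "\<rho> A0 + \<kappa> (B0 - S) = \<mu> B0" "\<rho>' A0 + \<kappa>' (B0 - S) = \<mu> B0"
    using v[OF B0] by (auto simp: A0_def)
  then obtain a a' where a: "\<rho> A0 = ereal a" "\<rho>' A0 = ereal a'"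
    using fin by (cases "\<rho> A0"; cases "\<rho>' A0"; cases "\<kappa> (B0 - S)"; cases "\<kappa>' (B0 - S)") auto
  have "\<kappa>' J = \<kappa> J + ereal (a - a')" if J: "J \<subseteq> E - S" "card J = r - q" for J
  proof (cases "J \<in> bases (E - S) (r - q) \<kappa>")
    case True
    then obtain B where B: "B \<in> max_bases E r \<mu> S" "J = B - S" using b by auto
    have m: "A0 \<union> J \<in> max_bases E r \<mu> S"
      using max_bases_product[OF vm S B(1) B0] B(2) by (simp add: A0_def)
    have "(A0 \<union> J) \<inter> S = A0" "(A0 \<union> J) - S = J" using J by (auto simp: A0_def)
    then have "\<mu> (A0 \<union> J) = ereal a + \<kappa> J" "\<mu> (A0 \<union> J) = ereal a' + \<kappa>' J"
      using v[OF m] a by simp_all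
    then show ?thesis
      by (cases "\<kappa> J"; cases "\<kappa>' J"; cases "\<mu> (A0 \<union> J)") auto
  next
    case False
    then have "J \<notin> bases (E - S) (r - q) \<kappa>'" using b by simp
    with False J have "\<kappa> J = \<infinity>" "\<kappa>' J = \<infinity>" by (auto simp: bases_def)
    then show ?thesis by simp
  qed
  then show ?thesis unfolding q_def by blast
qed

end

theory Submission
  imports Defs
begin

text \<open>
  A vector \<open>w\<close> over \<open>\<real> \<union> {\<infinity>}\<close> satisfies the circuit conditions of \<open>\<mu>\<close> iff it is a pointwise minimum
  of translated valuated cocircuits of \<open>\<mu>\<close>: among the bases with the largest intersection with the
  infinite coordinates of \<open>w\<close>, those minimising \<open>\<mu> B - (\<Sum>i\<in>B. w i)\<close> can be chosen through any
  given finite coordinate \<open>e\<close>, and the cocircuit of \<open>B - {e}\<close> then touches \<open>w\<close> from above at \<open>e\<close>.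
  The exchange property of a quotient says precisely that the cocircuits of \<open>\<mu>\<close> satisfy the circuit
  conditions of \<open>\<nu>\<close>, so a quotient is an inclusion of solution sets. As cocircuits of a contraction
  of \<open>\<mu>\<close> are cocircuits of \<open>\<mu>\<close> up to infinite coordinates, the solutions that are infinite on \<open>S\<close>
  are those of the contraction by \<open>S\<close>.
\<close>

subsection \<open>Tropical vanishing\<close>

text \<open>On a finite set: the minimum is infinite or attained at least twice.\<close>

definition tropically_vanishes :: "'a set \<Rightarrow> ('a \<Rightarrow> ereal) \<Rightarrow> bool" where
  "tropically_vanishes S f \<longleftrightarrow> (\<forall>e\<in>S. f e \<noteq> \<infinity> \<longrightarrow> (\<exists>j\<in>S - {e}. f j \<le> f e))"

lemma tropically_vanishesD:
  assumes "tropically_vanishes S f" "e \<in> S" "f e \<noteq> \<infinity>"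
  obtains j where "j \<in> S" "j \<noteq> e" "f j \<le> f e" "f j \<noteq> \<infinity>"
proof -
  obtain j where "j \<in> S - {e}" and "f j \<le> f e"
    using assms unfolding tropically_vanishes_def by blast
  moreover have "f j \<noteq> \<infinity>"
    using assms(3) \<open>f j \<le> f e\<close> by auto
  ultimately show thesis
    using that \<open>f j \<le> f e\<close> by blast
qed

lemma tropically_vanishes_cong:
  "(\<And>i. i \<in> S \<Longrightarrow> f i = g i) \<Longrightarrow> tropically_vanishes S f \<longleftrightarrow> tropically_vanishes S g"
  unfolding tropically_vanishes_def by simp

lemma tropically_vanishes_mono_neutral:
  assumes "S \<subseteq> T" and infinite: "\<And>i. i \<in> T - S \<Longrightarrow> f i = \<infinity>"
  shows "tropically_vanishes T f \<longleftrightarrow> tropically_vanishes S f"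
proof
  assume "tropically_vanishes T f"
  then show "tropically_vanishes S f"
    using assms unfolding tropically_vanishes_def
    by (metis Diff_iff ereal_infty_less_eq(1) subset_iff)
next
  assume "tropically_vanishes S f"
  then show "tropically_vanishes T f"
    using assms unfolding tropically_vanishes_def by blast
qed

lemma tropically_vanishes_add_const:
  "tropically_vanishes S (\<lambda>i. f i + ereal c) \<longleftrightarrow> tropically_vanishes S f"
proof -
  have "f j + ereal c \<le> f e + ereal c \<longleftrightarrow> f j \<le> f e" for j e
    by (cases "f j"; cases "f e") auto
  then show ?thesis
    unfolding tropically_vanishes_def by simp
qed

lemma min_attained_twice_iff_tropically_vanishes:
  assumes "finite E" and finite_entry: "\<exists>k\<in>E. C k \<noteq> \<infinity>"
  shows "min_attained_twice E C u \<longleftrightarrow> tropically_vanishes E (\<lambda>k. C k + ereal (u k))"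
    (is "_ \<longleftrightarrow> tropically_vanishes E ?f")
proof
  assume "min_attained_twice E C u"
  then obtain i j where "i \<noteq> j"
    and minima: "is_arg_min ?f (\<lambda>k. k \<in> E \<and> C k \<noteq> \<infinity>) i" "is_arg_min ?f (\<lambda>k. k \<in> E \<and> C k \<noteq> \<infinity>) j"
    unfolding min_attained_twice_def by blast
  show "tropically_vanishes E ?f"
    unfolding tropically_vanishes_def
  proof (intro ballI impI)
    fix e assume e: "e \<in> E" "?f e \<noteq> \<infinity>"
    then have "C e \<noteq> \<infinity>"
      by (metis plus_ereal.simps(2))
    define k where "k = (if i = e then j else i)"
    have "k \<noteq> e" "is_arg_min ?f (\<lambda>k. k \<in> E \<and> C k \<noteq> \<infinity>) k"
      using \<open>i \<noteq> j\<close> minima by (auto simp: k_def)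
    then show "\<exists>k\<in>E - {e}. ?f k \<le> ?f e"
      using e(1) \<open>C e \<noteq> \<infinity>\<close> unfolding is_arg_min_linorder by blast
  qed
next
  assume vanishes: "tropically_vanishes E ?f"
  have "finite {k \<in> E. C k \<noteq> \<infinity>}" "{k \<in> E. C k \<noteq> \<infinity>} \<noteq> {}"
    using assms by auto
  from ex_is_arg_min_if_finite[OF this, of ?f]
  obtain i where i: "is_arg_min ?f (\<lambda>k. k \<in> E \<and> C k \<noteq> \<infinity>) i"
    by auto
  then have "i \<in> E" "?f i \<noteq> \<infinity>"
    by (auto simp: is_arg_min_def)
  with vanishes obtain j where "j \<in> E" "j \<noteq> i" "?f j \<le> ?f i" "?f j \<noteq> \<infinity>"
    by (rule tropically_vanishesD)
  then have "is_arg_min ?f (\<lambda>k. k \<in> E \<and> C k \<noteq> \<infinity>) j"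
    using i unfolding is_arg_min_linorder by (auto intro: order_trans)
  with i \<open>j \<noteq> i\<close> show "min_attained_twice E C u"
    unfolding min_attained_twice_def by blast
qed

subsection \<open>Tropical vectors and tropical spans\<close>

abbreviation tropical_vectors :: "'a set \<Rightarrow> ('a \<Rightarrow> ereal) set" where
  "tropical_vectors E \<equiv> E \<rightarrow>\<^sub>E {x. x \<noteq> -\<infinity>}"

lemma tropical_vectors_not_MInfty: "w \<in> tropical_vectors E \<Longrightarrow> i \<in> E \<Longrightarrow> w i \<noteq> -\<infinity>"
  by (auto dest: PiE_mem)

lemma tropical_vectors_realE:
  assumes "w \<in> tropical_vectors E" "i \<in> E" "w i \<noteq> \<infinity>"
  obtains x where "w i = ereal x"
  using assms tropical_vectors_not_MInfty by (metis ereal_cases)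

text \<open>For finite \<open>E\<close>, these are the pointwise minima of translates of elements of \<open>V\<close>.\<close>

definition tropical_span :: "'a set \<Rightarrow> ('a \<Rightarrow> ereal) set \<Rightarrow> ('a \<Rightarrow> ereal) set" where
  "tropical_span E V = {w \<in> tropical_vectors E. \<forall>e\<in>E. w e \<noteq> \<infinity> \<longrightarrow>
     (\<exists>v\<in>V. \<exists>c::real. w e = v e + ereal c \<and> (\<forall>i\<in>E. w i \<le> v i + ereal c))}"

lemma tropical_spanE:
  assumes "w \<in> tropical_span E V" "e \<in> E" "w e \<noteq> \<infinity>"
  obtains v c where "v \<in> V" "w e = v e + ereal c" "\<forall>i\<in>E. w i \<le> v i + ereal c"
  using assms unfolding tropical_span_def by blast

lemma tropical_span_mono: "V \<subseteq> W \<Longrightarrow> tropical_span E V \<subseteq> tropical_span E W"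
  unfolding tropical_span_def by blast

lemma translate_in_tropical_span:
  assumes "v \<in> V" "v \<in> tropical_vectors E"
  shows "(\<lambda>i\<in>E. v i + ereal c) \<in> tropical_span E V"
  using assms unfolding tropical_span_def by (fastforce dest: tropical_vectors_not_MInfty)

subsection \<open>Tropical linear spaces\<close>

text \<open>The affine cone over the projective tropical linear space.\<close>

definition tropical_linear_space ::
    "'a set \<Rightarrow> nat \<Rightarrow> ('a set \<Rightarrow> ereal) \<Rightarrow> ('a \<Rightarrow> ereal) set" where
  "tropical_linear_space E r \<mu> = {w \<in> tropical_vectors E.
     \<forall>T\<subseteq>E. card T = r + 1 \<longrightarrow> tropically_vanishes T (\<lambda>i. \<mu> (T - {i}) + w i)}"

lemma tropical_linear_space_vanishes:
  "w \<in> tropical_linear_space E r \<mu> \<Longrightarrow> T \<subseteq> E \<Longrightarrow> card T = r + 1 \<Longrightarrow>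
    tropically_vanishes T (\<lambda>i. \<mu> (T - {i}) + w i)"
  unfolding tropical_linear_space_def by blast

lemma tropical_span_tropical_linear_space:
  "tropical_span E (tropical_linear_space E r \<mu>) \<subseteq> tropical_linear_space E r \<mu>"
proof
  fix w assume w: "w \<in> tropical_span E (tropical_linear_space E r \<mu>)"
  have "tropically_vanishes T (\<lambda>i. \<mu> (T - {i}) + w i)" if T: "T \<subseteq> E" "card T = r + 1" for T
    unfolding tropically_vanishes_def
  proof (intro ballI impI)
    fix e assume e: "e \<in> T" "\<mu> (T - {e}) + w e \<noteq> \<infinity>"
    then have "e \<in> E" "w e \<noteq> \<infinity>"
      using T by auto
    with w obtain v c where v: "v \<in> tropical_linear_space E r \<mu>"
      and w_e: "w e = v e + ereal c" and w_le: "\<forall>i\<in>E. w i \<le> v i + ereal c"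
      by (rule tropical_spanE)
    have "\<mu> (T - {e}) + v e \<noteq> \<infinity>"
      using e(2) w_e by auto
    then obtain j where j: "j \<in> T" "j \<noteq> e"
      and v_le: "\<mu> (T - {j}) + v j \<le> \<mu> (T - {e}) + v e"
      using tropical_linear_space_vanishes[OF v T] e(1) by (elim tropically_vanishesD)
    have "\<mu> (T - {j}) + w j \<le> \<mu> (T - {j}) + (v j + ereal c)"
      using w_le j T by (intro add_left_mono) blast
    also have "\<dots> \<le> \<mu> (T - {e}) + w e"
      unfolding w_e add.assoc[symmetric] using v_le by (rule add_right_mono)
    finally show "\<exists>j\<in>T - {e}. \<mu> (T - {j}) + w j \<le> \<mu> (T - {e}) + w e"
      using j by blast
  qed
  with w show "w \<in> tropical_linear_space E r \<mu>"
    unfolding tropical_linear_space_def tropical_span_def by blast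
qed

lemma translate_in_tropical_linear_space:
  assumes "w \<in> tropical_linear_space E r \<mu>"
  shows "(\<lambda>i\<in>E. w i + ereal c) \<in> tropical_linear_space E r \<mu>"
proof -
  have "w \<in> tropical_vectors E"
    using assms unfolding tropical_linear_space_def by blast
  then show ?thesis
    using translate_in_tropical_span[OF assms] tropical_span_tropical_linear_space by blast
qed

lemma tropically_vanishes_circuit_vector_iff:
  assumes "T \<subseteq> E"
  shows "tropically_vanishes E (\<lambda>i. circuit_vector E \<mu> T i + w i) \<longleftrightarrow>
    tropically_vanishes T (\<lambda>i. \<mu> (T - {i}) + w i)"
proof -
  have "tropically_vanishes E (\<lambda>i. circuit_vector E \<mu> T i + w i) \<longleftrightarrow>
      tropically_vanishes T (\<lambda>i. circuit_vector E \<mu> T i + w i)"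
    using assms by (intro tropically_vanishes_mono_neutral) (auto simp: circuit_vector_def)
  also have "\<dots> \<longleftrightarrow> tropically_vanishes T (\<lambda>i. \<mu> (T - {i}) + w i)"
    using assms by (intro tropically_vanishes_cong) (auto simp: circuit_vector_def)
  finally show ?thesis .
qed

lemma valuated_circuits_min_attained_twice_iff:
  assumes "finite E"
  shows "(\<forall>C\<in>valuated_circuits E r \<mu>. min_attained_twice E C u) \<longleftrightarrow>
    (\<lambda>i\<in>E. ereal (u i)) \<in> tropical_linear_space E r \<mu>"
proof -
  let ?C = "circuit_vector E \<mu>" and ?w = "\<lambda>i\<in>E. ereal (u i)"
  have circuit_iff: "(?C T \<noteq> (\<lambda>i\<in>E. \<infinity>) \<longrightarrow> min_attained_twice E (?C T) u) \<longleftrightarrow>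
      tropically_vanishes T (\<lambda>i. \<mu> (T - {i}) + ?w i)" if "T \<subseteq> E" for T
  proof (cases "\<exists>k\<in>E. ?C T k \<noteq> \<infinity>")
    case True
    then have "?C T \<noteq> (\<lambda>i\<in>E. \<infinity>)"
      by (metis restrict_apply')
    moreover have "min_attained_twice E (?C T) u \<longleftrightarrow> tropically_vanishes E (\<lambda>i. ?C T i + ?w i)"
      unfolding min_attained_twice_iff_tropically_vanishes[OF assms True]
      by (intro tropically_vanishes_cong) simp
    ultimately show ?thesis
      using tropically_vanishes_circuit_vector_iff[OF that] by simp
  next
    case False
    then have "?C T = (\<lambda>i\<in>E. \<infinity>)"
      by (auto simp: circuit_vector_def fun_eq_iff)
    moreover have "tropically_vanishes E (\<lambda>i. ?C T i + ?w i)"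
      using False by (simp add: tropically_vanishes_def)
    ultimately show ?thesis
      unfolding tropically_vanishes_circuit_vector_iff[OF that] by simp
  qed
  have "?w \<in> tropical_vectors E"
    by auto
  then show ?thesis
    unfolding tropical_linear_space_def valuated_circuits_def using circuit_iff by auto
qed

subsection \<open>Bases\<close>

lemma valuated_matroid_finite: "valuated_matroid E r \<mu> \<Longrightarrow> finite E"
  unfolding valuated_matroid_def matroid_bases_def by blast

lemma valuated_matroid_bases_nonempty: "valuated_matroid E r \<mu> \<Longrightarrow> bases E r \<mu> \<noteq> {}"
  unfolding valuated_matroid_def matroid_bases_def by blast

lemma valuated_matroid_not_MInfty:
  "valuated_matroid E r \<mu> \<Longrightarrow> I \<subseteq> E \<Longrightarrow> card I = r \<Longrightarrow> \<mu> I \<noteq> -\<infinity>"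
  unfolding valuated_matroid_def by blast

lemma valuated_matroid_self_quotient:
  "valuated_matroid E r \<mu> \<Longrightarrow> valuated_quotient E r \<mu> r \<mu>"
  unfolding valuated_matroid_def valuated_quotient_def by blast

lemma finite_bases: "finite E \<Longrightarrow> finite (bases E r \<mu>)"
  by (rule finite_subset[of _ "Pow E"]) (auto simp: bases_def)

lemma finite_basis: "finite E \<Longrightarrow> B \<in> bases E r \<mu> \<Longrightarrow> finite B"
  by (auto simp: bases_def intro: finite_subset)

lemma basis_value_real:
  assumes "valuated_matroid E r \<mu>" "B \<in> bases E r \<mu>"
  obtains b where "\<mu> B = ereal b"
  using assms valuated_matroid_not_MInfty[OF assms(1), of B] by (cases "\<mu> B") (auto simp: bases_def)

lemma exchange_in_bases:
  assumes "finite E" and B: "B \<in> bases E r \<mu>" and exchange: "j \<in> B" "i \<in> E - B"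
    and finite_value: "\<mu> (insert i (B - {j})) \<noteq> \<infinity>"
  shows "insert i (B - {j}) \<in> bases E r \<mu>"
proof -
  have "card (insert i (B - {j})) = card B"
    using finite_basis[OF assms(1) B] exchange card_Suc_Diff1[of B j] by simp
  then show ?thesis
    using assms by (auto simp: bases_def)
qed

lemma valuated_quotient_rank_le:
  assumes \<mu>: "valuated_matroid E r \<mu>" and \<nu>: "valuated_matroid E s \<nu>"
    and quotient: "valuated_quotient E r \<mu> s \<nu>"
  shows "r \<le> s"
proof -
  note finite_E = valuated_matroid_finite[OF \<mu>]
  obtain J where J: "J \<in> bases E s \<nu>"
    using valuated_matroid_bases_nonempty[OF \<nu>] by blast
  obtain I where I: "I \<in> bases E r \<mu>"
    and closest: "\<And>I'. I' \<in> bases E r \<mu> \<Longrightarrow> card (I - J) \<le> card (I' - J)"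
    using ex_is_arg_min_if_finite[OF finite_bases[OF finite_E]
        valuated_matroid_bases_nonempty[OF \<mu>], of "\<lambda>I. card (I - J)"]
    unfolding is_arg_min_linorder by blast
  have "I \<subseteq> J"
  proof (rule ccontr)
    assume "\<not> I \<subseteq> J"
    then obtain i where i: "i \<in> I - J"
      by blast
    with quotient I J obtain j where j: "j \<in> J - I"
      and exchange_le: "\<mu> (insert j (I - {i})) + \<nu> (insert i (J - {j})) \<le> \<mu> I + \<nu> J"
      unfolding valuated_quotient_def by blast
    have "\<mu> (insert j (I - {i})) \<noteq> \<infinity>"
      using exchange_le I J by (auto simp: bases_def)
    then have "insert j (I - {i}) \<in> bases E r \<mu>"
      using finite_E I J i j by (intro exchange_in_bases) (auto simp: bases_def)
    moreover have "insert j (I - {i}) - J \<subset> I - J"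
      using i j by auto
    then have "card (insert j (I - {i}) - J) < card (I - J)"
      using finite_basis[OF finite_E I] by (intro psubset_card_mono) auto
    ultimately show False
      using closest by fastforce
  qed
  then show ?thesis
    using card_mono[OF finite_basis[OF finite_E J]] I J by (auto simp: bases_def)
qed

lemma tropical_linear_space_basis_exchange:
  assumes "finite E" and w: "w \<in> tropical_linear_space E r \<mu>"
    and B: "B \<in> bases E r \<mu>" and e: "e \<in> E - B" "w e \<noteq> \<infinity>"
  obtains j where "j \<in> B" "w j \<noteq> \<infinity>" "\<mu> (insert e (B - {j})) \<noteq> \<infinity>"
    "\<mu> (insert e (B - {j})) + w j \<le> \<mu> B + w e"
proof -
  have "insert e B \<subseteq> E" "card (insert e B) = r + 1"
    using B e finite_basis[OF assms(1) B] by (auto simp: bases_def)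
  with w have "tropically_vanishes (insert e B) (\<lambda>i. \<mu> (insert e B - {i}) + w i)"
    by (rule tropical_linear_space_vanishes)
  moreover have remove_e: "insert e B - {e} = B"
    using e by blast
  then have "\<mu> (insert e B - {e}) + w e \<noteq> \<infinity>"
    using B e by (simp add: bases_def)
  ultimately obtain j where j: "j \<in> insert e B" "j \<noteq> e"
    and "\<mu> (insert e B - {j}) + w j \<le> \<mu> (insert e B - {e}) + w e"
      "\<mu> (insert e B - {j}) + w j \<noteq> \<infinity>"
    by (elim tropically_vanishesD) auto
  moreover have "insert e B - {j} = insert e (B - {j})"
    using j by blast
  ultimately show thesis
    using that[of j] remove_e by auto
qed

subsection \<open>Quotients and valuated cocircuits\<close>

definition cocircuit_vector :: "'a set \<Rightarrow> ('a set \<Rightarrow> ereal) \<Rightarrow> 'a set \<Rightarrow> 'a \<Rightarrow> ereal" where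
  "cocircuit_vector E \<mu> K = (\<lambda>i\<in>E. if i \<in> K then \<infinity> else \<mu> (insert i K))"

text \<open>Unlike \<^const>\<open>valuated_circuits\<close>, this may contain the all-infinite vector.\<close>

definition cocircuit_vectors :: "'a set \<Rightarrow> nat \<Rightarrow> ('a set \<Rightarrow> ereal) \<Rightarrow> ('a \<Rightarrow> ereal) set" where
  "cocircuit_vectors E r \<mu> = cocircuit_vector E \<mu> ` {K. K \<subseteq> E \<and> card K + 1 = r}"

lemma cocircuit_vector_in_tropical_vectors:
  assumes "valuated_matroid E r \<mu>" "K \<subseteq> E" "card K + 1 = r"
  shows "cocircuit_vector E \<mu> K \<in> tropical_vectors E"
proof -
  have "finite K"
    using assms valuated_matroid_finite finite_subset by blast
  then have "\<mu> (insert i K) \<noteq> -\<infinity>" if "i \<in> E - K" for i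
    using that assms by (intro valuated_matroid_not_MInfty[OF assms(1)]) auto
  then show ?thesis
    by (auto simp: cocircuit_vector_def)
qed

lemma cocircuit_vectors_subset_tropical_linear_space:
  assumes \<mu>: "valuated_matroid E r \<mu>" and quotient: "valuated_quotient E r \<mu> s \<nu>"
  shows "cocircuit_vectors E r \<mu> \<subseteq> tropical_linear_space E s \<nu>"
proof
  fix w assume "w \<in> cocircuit_vectors E r \<mu>"
  then obtain K where K: "K \<subseteq> E" "card K + 1 = r" and w: "w = cocircuit_vector E \<mu> K"
    unfolding cocircuit_vectors_def by blast
  have "tropically_vanishes T (\<lambda>i. \<nu> (T - {i}) + w i)" if T: "T \<subseteq> E" "card T = s + 1" for T
    unfolding tropically_vanishes_def
  proof (intro ballI impI)
    fix e assume e: "e \<in> T" "\<nu> (T - {e}) + w e \<noteq> \<infinity>"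
    have "finite T" "finite K"
      using K T valuated_matroid_finite[OF \<mu>] finite_subset by blast+
    have "e \<notin> K" and w_e: "w e = \<mu> (insert e K)"
      using e T by (auto simp: w cocircuit_vector_def split: if_splits)
    then have "insert e K \<in> bases E r \<mu>" "T - {e} \<in> bases E s \<nu>"
      using e T K \<open>finite T\<close> \<open>finite K\<close> by (auto simp: bases_def)
    moreover have "e \<in> insert e K - (T - {e})"
      by blast
    ultimately obtain j where j: "j \<in> (T - {e}) - insert e K"
      and exchange_le: "\<mu> (insert j (insert e K - {e})) + \<nu> (insert e (T - {e} - {j})) \<le>
        \<mu> (insert e K) + \<nu> (T - {e})"
      using quotient unfolding valuated_quotient_def by blast
    have "insert e K - {e} = K" "insert e (T - {e} - {j}) = T - {j}"
      using e j \<open>e \<notin> K\<close> by auto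
    moreover have "w j = \<mu> (insert j K)"
      using j T by (auto simp: w cocircuit_vector_def)
    ultimately have "\<nu> (T - {j}) + w j \<le> \<nu> (T - {e}) + w e"
      using exchange_le w_e by (simp add: add.commute)
    then show "\<exists>j\<in>T - {e}. \<nu> (T - {j}) + w j \<le> \<nu> (T - {e}) + w e"
      using j by blast
  qed
  moreover have "w \<in> tropical_vectors E"
    unfolding w using \<mu> K by (rule cocircuit_vector_in_tropical_vectors)
  ultimately show "w \<in> tropical_linear_space E s \<nu>"
    unfolding tropical_linear_space_def by blast
qed

lemma cocircuit_vector_of_basis:
  assumes "finite E" and B: "B \<in> bases E r \<mu>" and e: "e \<in> B"
  shows "cocircuit_vector E \<mu> (B - {e}) \<in> cocircuit_vectors E r \<mu>"
    and "cocircuit_vector E \<mu> (B - {e}) e = \<mu> B"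
proof -
  have "card (B - {e}) + 1 = r"
    using card_Suc_Diff1[OF finite_basis[OF assms(1) B] e] B by (simp add: bases_def)
  then show "cocircuit_vector E \<mu> (B - {e}) \<in> cocircuit_vectors E r \<mu>"
    using B unfolding cocircuit_vectors_def bases_def by blast
  show "cocircuit_vector E \<mu> (B - {e}) e = \<mu> B"
    using B e by (auto simp: cocircuit_vector_def bases_def insert_absorb)
qed

lemma valuated_quotientI_cocircuit_vectors:
  assumes "finite E" and cocircuits: "cocircuit_vectors E r \<mu> \<subseteq> tropical_linear_space E s \<nu>"
  shows "valuated_quotient E r \<mu> s \<nu>"
  unfolding valuated_quotient_def
proof (intro ballI)
  fix I J i assume I: "I \<in> bases E r \<mu>" and J: "J \<in> bases E s \<nu>" and i: "i \<in> I - J"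
  define w where "w = cocircuit_vector E \<mu> (I - {i})"
  have w_i: "w i = \<mu> I" and w: "w \<in> tropical_linear_space E s \<nu>"
    using cocircuit_vector_of_basis[OF assms(1) I] i cocircuits unfolding w_def by blast+
  have "i \<in> E - J" "w i \<noteq> \<infinity>"
    using I i w_i by (auto simp: bases_def)
  with assms(1) w J obtain j where j: "j \<in> J" and "w j \<noteq> \<infinity>"
    and exchange_le: "\<nu> (insert i (J - {j})) + w j \<le> \<nu> J + w i"
    by (rule tropical_linear_space_basis_exchange)
  have "j \<in> E" "j \<noteq> i"
    using J i j by (auto simp: bases_def)
  then have "j \<notin> I" "w j = \<mu> (insert j (I - {i}))"
    using \<open>w j \<noteq> \<infinity>\<close> by (auto simp: w_def cocircuit_vector_def split: if_splits)
  then show "\<exists>j\<in>J - I. \<mu> (insert j (I - {i})) + \<nu> (insert i (J - {j})) \<le> \<mu> I + \<nu> J"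
    using j exchange_le w_i by (auto simp: add.commute)
qed

subsection \<open>Tropical linear spaces are spanned by cocircuits\<close>

definition tropical_weight :: "('a set \<Rightarrow> ereal) \<Rightarrow> ('a \<Rightarrow> ereal) \<Rightarrow> 'a set \<Rightarrow> ereal" where
  "tropical_weight \<mu> w B = \<mu> B - ereal (\<Sum>i\<in>{i\<in>B. w i \<noteq> \<infinity>}. real_of_ereal (w i))"

text \<open>
  The bases of the initial matroid of \<open>\<mu>\<close> at \<open>w\<close>: infinite coordinates of \<open>w\<close> outweigh all finite
  ones, so the number of them in a basis is maximised first.
\<close>

definition optimal_bases :: "'a set \<Rightarrow> nat \<Rightarrow> ('a set \<Rightarrow> ereal) \<Rightarrow> ('a \<Rightarrow> ereal) \<Rightarrow> 'a set set" where
  "optimal_bases E r \<mu> w =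
     {B. is_arg_min (tropical_weight \<mu> w) (\<lambda>B. B \<in> max_bases E r \<mu> {i \<in> E. w i = \<infinity>}) B}"

lemma max_bases_subset_bases: "max_bases E r \<mu> S \<subseteq> bases E r \<mu>"
  unfolding max_bases_def by blast

lemma optimal_bases_subset_max_bases: "optimal_bases E r \<mu> w \<subseteq> max_bases E r \<mu> {i \<in> E. w i = \<infinity>}"
  unfolding optimal_bases_def is_arg_min_def by blast

lemma optimal_bases_subset_bases: "optimal_bases E r \<mu> w \<subseteq> bases E r \<mu>"
  using optimal_bases_subset_max_bases max_bases_subset_bases by (rule order_trans)

lemma optimal_bases_nonempty:
  assumes "valuated_matroid E r \<mu>"
  shows "optimal_bases E r \<mu> w \<noteq> {}"
proof -
  let ?M = "max_bases E r \<mu> {i \<in> E. w i = \<infinity>}"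
  have "finite ?M"
    using max_bases_subset_bases finite_bases[OF valuated_matroid_finite[OF assms]]
    by (rule finite_subset)
  moreover have "?M \<noteq> {}"
    using max_bases_nonempty[OF assms] by blast
  ultimately show ?thesis
    unfolding optimal_bases_def using ex_is_arg_min_if_finite by blast
qed

text \<open>
  Removing \<open>j \<notin> S\<close> does not shrink the intersection with \<open>S\<close>, which cannot grow by adding \<open>i\<close>.
\<close>

lemma max_bases_exchange_outside:
  assumes "finite E" and B: "B \<in> max_bases E r \<mu> S" and exchange: "j \<in> B - S" "i \<in> E - B"
    and finite_value: "\<mu> (insert i (B - {j})) \<noteq> \<infinity>"
  shows "insert i (B - {j}) \<in> max_bases E r \<mu> S" "i \<notin> S"
proof -
  have B_basis: "B \<in> bases E r \<mu>"
    and maximal: "\<And>B'. B' \<in> bases E r \<mu> \<Longrightarrow> card (B' \<inter> S) \<le> card (B \<inter> S)"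
    using B unfolding max_bases_def by blast+
  note finite_B = finite_basis[OF assms(1) B_basis]
  have basis: "insert i (B - {j}) \<in> bases E r \<mu>"
    using exchange_in_bases[OF assms(1) B_basis _ _ finite_value] exchange by blast
  have "card (B \<inter> S) \<le> card (insert i (B - {j}) \<inter> S)"
    using exchange finite_B by (intro card_mono) auto
  then show "insert i (B - {j}) \<in> max_bases E r \<mu> S"
    using basis maximal unfolding max_bases_def by (auto intro: order_trans)
  show "i \<notin> S"
  proof
    assume "i \<in> S"
    then have "insert i (B - {j}) \<inter> S = insert i (B \<inter> S)"
      using exchange by auto
    then have "card (insert i (B - {j}) \<inter> S) = Suc (card (B \<inter> S))"
      using exchange finite_B by simp
    then show False
      using maximal[OF basis] by simp
  qed
qed

lemma tropical_weight_exchange: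
  assumes "finite B" "j \<in> B" "i \<notin> B" and w: "w i = ereal x" "w j = ereal y"
  shows "tropical_weight \<mu> w (insert i (B - {j})) \<le> tropical_weight \<mu> w B \<longleftrightarrow>
      \<mu> (insert i (B - {j})) + w j \<le> \<mu> B + w i"
    and "tropical_weight \<mu> w B \<le> tropical_weight \<mu> w (insert i (B - {j})) \<longleftrightarrow>
      \<mu> B + w i \<le> \<mu> (insert i (B - {j})) + w j"
proof -
  let ?B' = "insert i (B - {j})" and ?F = "\<lambda>B. {i \<in> B. w i \<noteq> \<infinity>}"
  define \<sigma> where "\<sigma> = (\<Sum>i\<in>?F B - {j}. real_of_ereal (w i))"
  have "?F ?B' = insert i (?F B - {j})"
    using w by auto
  then have weight_B': "tropical_weight \<mu> w ?B' = \<mu> ?B' - ereal (x + \<sigma>)"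
    using assms by (simp add: tropical_weight_def \<sigma>_def)
  have "(\<Sum>i\<in>?F B. real_of_ereal (w i)) = y + \<sigma>"
    using assms by (subst sum.remove[of _ j]) (auto simp: \<sigma>_def)
  then have weight_B: "tropical_weight \<mu> w B = \<mu> B - ereal (y + \<sigma>)"
    by (simp add: tropical_weight_def)
  have shift: "p - ereal (s + \<sigma>) \<le> q - ereal (t + \<sigma>) \<longleftrightarrow> p + ereal t \<le> q + ereal s" for p q s t
    by (cases p; cases q) auto
  show "tropical_weight \<mu> w ?B' \<le> tropical_weight \<mu> w B \<longleftrightarrow> \<mu> ?B' + w j \<le> \<mu> B + w i"
    "tropical_weight \<mu> w B \<le> tropical_weight \<mu> w ?B' \<longleftrightarrow> \<mu> B + w i \<le> \<mu> ?B' + w j"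
    unfolding weight_B weight_B' w by (rule shift)+
qed

lemma optimal_basis_le_cocircuit_vector:
  assumes \<mu>: "valuated_matroid E r \<mu>" and w: "w \<in> tropical_vectors E"
    and B: "B \<in> optimal_bases E r \<mu> w" and e: "e \<in> B" "w e \<noteq> \<infinity>" and i: "i \<in> E"
  shows "\<mu> B + w i \<le> cocircuit_vector E \<mu> (B - {e}) i + w e"
proof -
  let ?Z = "{i \<in> E. w i = \<infinity>}" and ?B' = "insert i (B - {e})"
  note finite_E = valuated_matroid_finite[OF \<mu>]
  have B_basis: "B \<in> bases E r \<mu>" and B_max: "B \<in> max_bases E r \<mu> ?Z"
    using B optimal_bases_subset_bases optimal_bases_subset_max_bases by blast+
  consider (touching) "i = e" | (in_basis) "i \<in> B - {e}"
    | (dependent) "i \<in> E - B" "\<mu> ?B' = \<infinity>" | (exchange) "i \<in> E - B" "\<mu> ?B' \<noteq> \<infinity>"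
    using i by blast
  then show ?thesis
  proof cases
    case exchange
    have "e \<in> B - ?Z" "e \<in> E"
      using e B_basis by (auto simp: bases_def)
    note max_exchange = max_bases_exchange_outside[OF finite_E B_max \<open>e \<in> B - ?Z\<close> exchange]
    have "w i \<noteq> \<infinity>"
      using i max_exchange(2) by simp
    then obtain x y where "w i = ereal x" "w e = ereal y"
      using e(2) i \<open>e \<in> E\<close> tropical_vectors_realE[OF w] by metis
    moreover have "tropical_weight \<mu> w B \<le> tropical_weight \<mu> w ?B'"
      using B max_exchange(1) unfolding optimal_bases_def is_arg_min_linorder by blast
    ultimately have "\<mu> B + w i \<le> \<mu> ?B' + w e"
      using tropical_weight_exchange(2)[OF finite_basis[OF finite_E B_basis] e(1)] exchange by blast
    then show ?thesis
      using exchange by (simp add: cocircuit_vector_def)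
  qed (use e i B_basis in \<open>auto simp: cocircuit_vector_def bases_def insert_absorb\<close>)
qed

lemma optimal_basis_through:
  assumes \<mu>: "valuated_matroid E r \<mu>" and w: "w \<in> tropical_linear_space E r \<mu>"
    and e: "e \<in> E" "w e \<noteq> \<infinity>"
  obtains B where "B \<in> optimal_bases E r \<mu> w" "e \<in> B"
proof -
  let ?Z = "{i \<in> E. w i = \<infinity>}"
  note finite_E = valuated_matroid_finite[OF \<mu>]
  obtain B where B: "B \<in> optimal_bases E r \<mu> w"
    using optimal_bases_nonempty[OF \<mu>] by blast
  then have B_basis: "B \<in> bases E r \<mu>" and B_max: "B \<in> max_bases E r \<mu> ?Z"
    using optimal_bases_subset_bases optimal_bases_subset_max_bases by blast+
  show thesis
  proof (cases "e \<in> B")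
    case False
    then have "e \<in> E - B"
      using e by blast
    with finite_E w B_basis obtain j
      where j: "j \<in> B" "w j \<noteq> \<infinity>" "\<mu> (insert e (B - {j})) \<noteq> \<infinity>"
        and exchange_le: "\<mu> (insert e (B - {j})) + w j \<le> \<mu> B + w e"
      using e(2) by (rule tropical_linear_space_basis_exchange)
    have "j \<in> B - ?Z"
      using j by simp
    with B_max have exchange_max: "insert e (B - {j}) \<in> max_bases E r \<mu> ?Z"
      using \<open>e \<in> E - B\<close> j(3) by (rule max_bases_exchange_outside[OF finite_E])
    have "w \<in> tropical_vectors E" "j \<in> E"
      using w j B_basis unfolding tropical_linear_space_def bases_def by blast+
    then obtain x y where "w e = ereal x" "w j = ereal y"
      using e j(2) tropical_vectors_realE by metis
    then have "tropical_weight \<mu> w (insert e (B - {j})) \<le> tropical_weight \<mu> w B"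
      using tropical_weight_exchange(1)[OF finite_basis[OF finite_E B_basis] j(1) False]
        exchange_le by simp
    with B exchange_max have "insert e (B - {j}) \<in> optimal_bases E r \<mu> w"
      unfolding optimal_bases_def is_arg_min_linorder by (auto intro: order_trans)
    then show thesis
      using that by blast
  qed (use B that in blast)
qed

lemma tropical_linear_space_subset_span_cocircuit_vectors:
  assumes \<mu>: "valuated_matroid E r \<mu>"
  shows "tropical_linear_space E r \<mu> \<subseteq> tropical_span E (cocircuit_vectors E r \<mu>)"
proof
  fix w assume w: "w \<in> tropical_linear_space E r \<mu>"
  then have w_vector: "w \<in> tropical_vectors E"
    unfolding tropical_linear_space_def by blast
  have "\<exists>v\<in>cocircuit_vectors E r \<mu>. \<exists>c. w e = v e + ereal c \<and> (\<forall>i\<in>E. w i \<le> v i + ereal c)"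
    if e: "e \<in> E" "w e \<noteq> \<infinity>" for e
  proof -
    obtain B where B: "B \<in> optimal_bases E r \<mu> w" "e \<in> B"
      using optimal_basis_through[OF \<mu> w e] .
    then have B_basis: "B \<in> bases E r \<mu>"
      using optimal_bases_subset_bases by blast
    define v where "v = cocircuit_vector E \<mu> (B - {e})"
    have v: "v \<in> cocircuit_vectors E r \<mu>" "v e = \<mu> B"
      unfolding v_def
      using cocircuit_vector_of_basis[OF valuated_matroid_finite[OF \<mu>] B_basis B(2)] .
    obtain b x where b: "\<mu> B = ereal b" and x: "w e = ereal x"
      using basis_value_real[OF \<mu> B_basis] tropical_vectors_realE[OF w_vector e] by metis
    have "w i \<le> v i + ereal (x - b)" if "i \<in> E" for i
      using optimal_basis_le_cocircuit_vector[OF \<mu> w_vector B e(2) that]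
      unfolding v_def[symmetric] b x by (cases "w i"; cases "v i") auto
    moreover have "w e = v e + ereal (x - b)"
      using v(2) b x by simp
    ultimately show ?thesis
      using v(1) by blast
  qed
  then show "w \<in> tropical_span E (cocircuit_vectors E r \<mu>)"
    using w_vector unfolding tropical_span_def by blast
qed

lemma tropical_span_cocircuit_vectors_subset:
  assumes "valuated_matroid E r \<mu>" "valuated_quotient E r \<mu> s \<nu>"
  shows "tropical_span E (cocircuit_vectors E r \<mu>) \<subseteq> tropical_linear_space E s \<nu>"
  using tropical_span_mono[OF cocircuit_vectors_subset_tropical_linear_space[OF assms]]
    tropical_span_tropical_linear_space by (rule order_trans)

lemma tropical_linear_space_eq_span_cocircuit_vectors:
  assumes "valuated_matroid E r \<mu>"
  shows "tropical_linear_space E r \<mu> = tropical_span E (cocircuit_vectors E r \<mu>)"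
  using tropical_linear_space_subset_span_cocircuit_vectors[OF assms]
    tropical_span_cocircuit_vectors_subset[OF assms valuated_matroid_self_quotient[OF assms]]
  by blast

lemma valuated_quotient_iff_tropical_linear_space_subset:
  assumes "valuated_matroid E r \<mu>"
  shows "valuated_quotient E r \<mu> s \<nu> \<longleftrightarrow>
    tropical_linear_space E r \<mu> \<subseteq> tropical_linear_space E s \<nu>"
proof
  assume "valuated_quotient E r \<mu> s \<nu>"
  then show "tropical_linear_space E r \<mu> \<subseteq> tropical_linear_space E s \<nu>"
    unfolding tropical_linear_space_eq_span_cocircuit_vectors[OF assms]
    by (rule tropical_span_cocircuit_vectors_subset[OF assms])
next
  assume subset: "tropical_linear_space E r \<mu> \<subseteq> tropical_linear_space E s \<nu>"
  have "cocircuit_vectors E r \<mu> \<subseteq> tropical_linear_space E r \<mu>"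
    using assms valuated_matroid_self_quotient[OF assms]
    by (rule cocircuit_vectors_subset_tropical_linear_space)
  with subset show "valuated_quotient E r \<mu> s \<nu>"
    by (intro valuated_quotientI_cocircuit_vectors valuated_matroid_finite[OF assms]) blast
qed

subsection \<open>Contractions\<close>

lemma card_Int_le_matroid_rank:
  assumes "valuated_matroid E r \<mu>" "B \<in> bases E r \<mu>"
  shows "card (B \<inter> S) \<le> matroid_rank E r \<mu> S"
  unfolding matroid_rank_def using assms finite_bases[OF valuated_matroid_finite[OF assms(1)]]
  by (intro Max_ge) auto

lemma matroid_rank_le:
  assumes "valuated_matroid E r \<mu>"
  shows "matroid_rank E r \<mu> S \<le> r"
proof -
  obtain B where B: "B \<in> max_bases E r \<mu> S"
    using max_bases_nonempty[OF assms] by blast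
  then have "B \<in> bases E r \<mu>"
    using max_bases_subset_bases by blast
  then have "finite B" "card B = r"
    using finite_basis valuated_matroid_finite[OF assms] unfolding bases_def by blast+
  then show ?thesis
    using matroid_rank_eq[OF assms B] card_mono[of B "B \<inter> S"] by simp
qed

lemma card_Un_subset_Diff:
  assumes "finite E" "S \<subseteq> E" "A \<subseteq> S" "J \<subseteq> E - S"
  shows "card (A \<union> J) = card A + card J"
proof (rule card_Un_disjoint)
  show "finite A" "finite J"
    using assms finite_subset[OF _ assms(1)] by blast+
  show "A \<inter> J = {}"
    using assms by blast
qed

lemma max_bases_iff_matroid_rank:
  assumes "valuated_matroid E r \<mu>"
  shows "B \<in> max_bases E r \<mu> S \<longleftrightarrow>
    B \<in> bases E r \<mu> \<and> card (B \<inter> S) = matroid_rank E r \<mu> S"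
proof
  assume "B \<in> max_bases E r \<mu> S"
  then show "B \<in> bases E r \<mu> \<and> card (B \<inter> S) = matroid_rank E r \<mu> S"
    using matroid_rank_eq[OF assms] max_bases_subset_bases by (metis subsetD)
next
  assume "B \<in> bases E r \<mu> \<and> card (B \<inter> S) = matroid_rank E r \<mu> S"
  then show "B \<in> max_bases E r \<mu> S"
    using card_Int_le_matroid_rank[OF assms, of _ S] unfolding max_bases_def by auto
qed

lemma contraction_is_restriction_contraction:
  assumes "valuated_matroid E r \<mu>" "S \<subseteq> E"
  obtains \<rho> where "is_restriction_contraction E r \<mu> S \<rho> (contraction E r \<mu> S)"
proof -
  have "\<exists>\<kappa> \<rho>. is_restriction_contraction E r \<mu> S \<rho> \<kappa>"
    using contraction_exists[OF assms] by blast
  then have "\<exists>\<rho>. is_restriction_contraction E r \<mu> S \<rho> (contraction E r \<mu> S)"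
    unfolding contraction_def by (rule someI_ex)
  then show thesis
    using that by (elim exE)
qed

lemma
  assumes "valuated_matroid E r \<mu>" "S \<subseteq> E"
  shows valuated_matroid_contraction:
      "valuated_matroid (E - S) (r - matroid_rank E r \<mu> S) (contraction E r \<mu> S)"
    and bases_contraction:
      "bases (E - S) (r - matroid_rank E r \<mu> S) (contraction E r \<mu> S) =
        (\<lambda>B. B - S) ` max_bases E r \<mu> S"
proof -
  obtain \<rho> where "is_restriction_contraction E r \<mu> S \<rho> (contraction E r \<mu> S)"
    using contraction_is_restriction_contraction[OF assms] .
  then show "valuated_matroid (E - S) (r - matroid_rank E r \<mu> S) (contraction E r \<mu> S)"
    "bases (E - S) (r - matroid_rank E r \<mu> S) (contraction E r \<mu> S) =
      (\<lambda>B. B - S) ` max_bases E r \<mu> S"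
    unfolding is_restriction_contraction_def Let_def by blast+
qed

lemma Un_in_bases_iff_contraction:
  assumes \<mu>: "valuated_matroid E r \<mu>" and S: "S \<subseteq> E"
    and B: "B \<in> max_bases E r \<mu> S" and J: "J \<subseteq> E - S"
  shows "(B \<inter> S) \<union> J \<in> bases E r \<mu> \<longleftrightarrow>
    J \<in> bases (E - S) (r - matroid_rank E r \<mu> S) (contraction E r \<mu> S)"
proof
  have Int_Diff: "(B \<inter> S \<union> J) \<inter> S = B \<inter> S" "B \<inter> S \<union> J - S = J"
    using J by auto
  assume "(B \<inter> S) \<union> J \<in> bases E r \<mu>"
  then have "(B \<inter> S) \<union> J \<in> max_bases E r \<mu> S"
    using B Int_Diff(1) unfolding max_bases_iff_matroid_rank[OF \<mu>] by simp
  then have "B \<inter> S \<union> J - S \<in> bases (E - S) (r - matroid_rank E r \<mu> S) (contraction E r \<mu> S)"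
    unfolding bases_contraction[OF \<mu> S] by (rule imageI)
  then show "J \<in> bases (E - S) (r - matroid_rank E r \<mu> S) (contraction E r \<mu> S)"
    unfolding Int_Diff(2) .
next
  assume "J \<in> bases (E - S) (r - matroid_rank E r \<mu> S) (contraction E r \<mu> S)"
  then obtain B' where B': "B' \<in> max_bases E r \<mu> S" "J = B' - S"
    unfolding bases_contraction[OF \<mu> S] by blast
  then show "(B \<inter> S) \<union> J \<in> bases E r \<mu>"
    using max_bases_product[OF \<mu> S B'(1) B] max_bases_subset_bases by blast
qed

lemma max_basis_Un_value:
  assumes \<mu>: "valuated_matroid E r \<mu>" and S: "S \<subseteq> E"
    and split: "is_restriction_contraction E r \<mu> S \<rho> (contraction E r \<mu> S)"
    and B: "B \<in> max_bases E r \<mu> S" and J: "J \<subseteq> E - S" "card J = r - matroid_rank E r \<mu> S"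
  shows "\<mu> ((B \<inter> S) \<union> J) = \<rho> (B \<inter> S) + contraction E r \<mu> S J"
proof -
  have Int_Diff: "(B \<inter> S \<union> J) \<inter> S = B \<inter> S" "B \<inter> S \<union> J - S = J"
    using J by auto
  have rank: "card (B \<inter> S) = matroid_rank E r \<mu> S"
    using B unfolding max_bases_iff_matroid_rank[OF \<mu>] by blast
  show ?thesis
  proof (cases "B \<inter> S \<union> J \<in> bases E r \<mu>")
    case True
    then have "B \<inter> S \<union> J \<in> max_bases E r \<mu> S"
      using Int_Diff(1) rank unfolding max_bases_iff_matroid_rank[OF \<mu>] by simp
    with split have "\<mu> (B \<inter> S \<union> J) =
        \<rho> ((B \<inter> S \<union> J) \<inter> S) + contraction E r \<mu> S (B \<inter> S \<union> J - S)"
      unfolding is_restriction_contraction_def Let_def by blast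
    then show ?thesis
      unfolding Int_Diff .
  next
    case False
    have "card (B \<inter> S \<union> J) = r"
      using card_Un_subset_Diff[OF valuated_matroid_finite[OF \<mu>] S _ J(1)] J(2) rank
        matroid_rank_le[OF \<mu>, of S] by simp
    moreover have "B \<inter> S \<union> J \<subseteq> E"
      using J(1) S by blast
    moreover have "J \<notin> bases (E - S) (r - matroid_rank E r \<mu> S) (contraction E r \<mu> S)"
      using False Un_in_bases_iff_contraction[OF \<mu> S B J(1)] by blast
    ultimately show ?thesis
      using False J by (simp add: bases_def)
  qed
qed

definition contraction_lift ::
    "'a set \<Rightarrow> nat \<Rightarrow> ('a set \<Rightarrow> ereal) \<Rightarrow> 'a set \<Rightarrow> 'a set \<Rightarrow> real \<Rightarrow> bool" where
  "contraction_lift E r \<mu> S A a \<longleftrightarrow> A \<subseteq> S \<and> card A = matroid_rank E r \<mu> S \<and>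
     (\<forall>J\<subseteq>E - S. card J = r - matroid_rank E r \<mu> S \<longrightarrow>
        \<mu> (A \<union> J) = contraction E r \<mu> S J + ereal a)"

lemma contraction_lift_value:
  "contraction_lift E r \<mu> S A a \<Longrightarrow> J \<subseteq> E - S \<Longrightarrow> card J = r - matroid_rank E r \<mu> S \<Longrightarrow>
    \<mu> (A \<union> J) = contraction E r \<mu> S J + ereal a"
  unfolding contraction_lift_def by blast

lemma contraction_lift_exists:
  assumes \<mu>: "valuated_matroid E r \<mu>" and S: "S \<subseteq> E"
  obtains A a where "contraction_lift E r \<mu> S A a"
proof -
  obtain B where B: "B \<in> max_bases E r \<mu> S"
    using max_bases_nonempty[OF \<mu>] by blast
  obtain \<rho> where split: "is_restriction_contraction E r \<mu> S \<rho> (contraction E r \<mu> S)"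
    using contraction_is_restriction_contraction[OF assms] .
  then have "\<mu> B = \<rho> (B \<inter> S) + contraction E r \<mu> S (B - S)"
    using B unfolding is_restriction_contraction_def Let_def by blast
  then obtain a where a: "\<rho> (B \<inter> S) = ereal a"
    using max_bases_finite_value[OF \<mu> B]
    by (cases "\<rho> (B \<inter> S)"; cases "contraction E r \<mu> S (B - S)") auto
  have "contraction_lift E r \<mu> S (B \<inter> S) a"
    using max_basis_Un_value[OF \<mu> S split B] B
    unfolding contraction_lift_def max_bases_iff_matroid_rank[OF \<mu>] a by (simp add: add.commute)
  then show thesis
    using that by blast
qed

lemma tropically_vanishes_contraction_lift_iff:
  assumes \<mu>: "valuated_matroid E r \<mu>" and lift: "contraction_lift E r \<mu> S A a"
    and T: "T \<subseteq> E - S" "card T = r - matroid_rank E r \<mu> S + 1"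
    and infinite: "\<forall>i\<in>S. w i = \<infinity>"
  shows "tropically_vanishes (A \<union> T) (\<lambda>i. \<mu> (A \<union> T - {i}) + w i) \<longleftrightarrow>
    tropically_vanishes T (\<lambda>i. contraction E r \<mu> S (T - {i}) + w i)"
proof -
  have "A \<subseteq> S"
    using lift unfolding contraction_lift_def by blast
  have "tropically_vanishes (A \<union> T) (\<lambda>i. \<mu> (A \<union> T - {i}) + w i) \<longleftrightarrow>
      tropically_vanishes T (\<lambda>i. \<mu> (A \<union> T - {i}) + w i)"
    using \<open>A \<subseteq> S\<close> infinite by (intro tropically_vanishes_mono_neutral) auto
  also have "\<dots> \<longleftrightarrow> tropically_vanishes T (\<lambda>i. contraction E r \<mu> S (T - {i}) + w i + ereal a)"
  proof (rule tropically_vanishes_cong)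
    fix i assume i: "i \<in> T"
    have "finite T"
      using T(1) valuated_matroid_finite[OF \<mu>] finite_subset by blast
    then have "card (T - {i}) = r - matroid_rank E r \<mu> S"
      using T(2) i by simp
    with T(1) have "\<mu> (A \<union> (T - {i})) = contraction E r \<mu> S (T - {i}) + ereal a"
      by (intro contraction_lift_value[OF lift]) blast+
    moreover have "A \<union> T - {i} = A \<union> (T - {i})"
      using i T(1) \<open>A \<subseteq> S\<close> by blast
    ultimately show "\<mu> (A \<union> T - {i}) + w i = contraction E r \<mu> S (T - {i}) + w i + ereal a"
      by (simp add: ac_simps)
  qed
  also have "\<dots> \<longleftrightarrow> tropically_vanishes T (\<lambda>i. contraction E r \<mu> S (T - {i}) + w i)"
    by (rule tropically_vanishes_add_const)
  finally show ?thesis .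
qed

lemma restrict_in_tropical_linear_space_contraction:
  assumes \<mu>: "valuated_matroid E r \<mu>" and S: "S \<subseteq> E"
    and w: "w \<in> tropical_linear_space E r \<mu>" and infinite: "\<forall>i\<in>S. w i = \<infinity>"
  shows "restrict w (E - S) \<in>
    tropical_linear_space (E - S) (r - matroid_rank E r \<mu> S) (contraction E r \<mu> S)"
proof -
  let ?q = "matroid_rank E r \<mu> S" and ?\<kappa> = "contraction E r \<mu> S"
  obtain A a where lift: "contraction_lift E r \<mu> S A a"
    using contraction_lift_exists[OF \<mu> S] .
  then have A: "A \<subseteq> S" "card A = ?q"
    unfolding contraction_lift_def by blast+
  have "tropically_vanishes T (\<lambda>i. ?\<kappa> (T - {i}) + restrict w (E - S) i)"
    if T: "T \<subseteq> E - S" "card T = r - ?q + 1" for T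
  proof -
    have "card (A \<union> T) = r + 1"
      using card_Un_subset_Diff[OF valuated_matroid_finite[OF \<mu>] S A(1) T(1)] A(2) T(2)
        matroid_rank_le[OF \<mu>, of S] by simp
    moreover have "A \<union> T \<subseteq> E"
      using A(1) T(1) S by blast
    ultimately have "tropically_vanishes (A \<union> T) (\<lambda>i. \<mu> (A \<union> T - {i}) + w i)"
      using tropical_linear_space_vanishes[OF w] by blast
    then have "tropically_vanishes T (\<lambda>i. ?\<kappa> (T - {i}) + w i)"
      using tropically_vanishes_contraction_lift_iff[OF \<mu> lift T infinite] by blast
    moreover have "restrict w (E - S) i = w i" if "i \<in> T" for i
      using that T(1) by auto
    then have "tropically_vanishes T (\<lambda>i. ?\<kappa> (T - {i}) + restrict w (E - S) i) \<longleftrightarrow>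
        tropically_vanishes T (\<lambda>i. ?\<kappa> (T - {i}) + w i)"
      by (intro tropically_vanishes_cong) simp
    ultimately show ?thesis
      by blast
  qed
  moreover have "w \<in> tropical_vectors E"
    using w unfolding tropical_linear_space_def by blast
  then have "restrict w (E - S) \<in> tropical_vectors (E - S)"
    by (auto dest: PiE_mem)
  ultimately show ?thesis
    unfolding tropical_linear_space_def by blast
qed

lemma cocircuit_vector_Un_contraction_lift:
  assumes \<mu>: "valuated_matroid E r \<mu>" and S: "S \<subseteq> E" and lift: "contraction_lift E r \<mu> S A a"
    and K: "K \<subseteq> E - S" "card K + 1 = r - matroid_rank E r \<mu> S" and l: "l \<in> E"
  shows "cocircuit_vector E \<mu> (A \<union> K) l =
    (if l \<in> S then \<infinity> else cocircuit_vector (E - S) (contraction E r \<mu> S) K l + ereal a)"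
proof -
  have A: "A \<subseteq> S" "card A = matroid_rank E r \<mu> S"
    using lift unfolding contraction_lift_def by blast+
  have "finite A" "finite K"
    using A(1) K(1) S finite_subset[OF _ valuated_matroid_finite[OF \<mu>]] by blast+
  consider (in_union) "l \<in> A \<union> K" | (dependent) "l \<in> S - A" | (outside) "l \<in> E - S - K"
    using l by blast
  then show ?thesis
  proof cases
    case in_union
    then show ?thesis
      using A(1) K(1) S by (auto simp: cocircuit_vector_def)
  next
    case dependent
    have "insert l (A \<union> K) \<inter> S = insert l A"
      using dependent A(1) K(1) by auto
    then have "card (insert l (A \<union> K) \<inter> S) = matroid_rank E r \<mu> S + 1"
      using dependent A(2) \<open>finite A\<close> by simp
    then have "insert l (A \<union> K) \<notin> bases E r \<mu>"
      using card_Int_le_matroid_rank[OF \<mu>, of _ S] by fastforce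
    moreover have "card (insert l A \<union> K) = r"
      using card_Un_subset_Diff[OF valuated_matroid_finite[OF \<mu>] S _ K(1), of "insert l A"]
        dependent A K(2) \<open>finite A\<close> by simp
    ultimately show ?thesis
      using dependent A(1) K(1) S by (auto simp: cocircuit_vector_def bases_def)
  next
    case outside
    then have "card (insert l K) = r - matroid_rank E r \<mu> S"
      using K(2) \<open>finite K\<close> by simp
    then have "\<mu> (A \<union> insert l K) = contraction E r \<mu> S (insert l K) + ereal a"
      using outside K(1) by (intro contraction_lift_value[OF lift]) blast+
    then show ?thesis
      using outside A(1) by (auto simp: cocircuit_vector_def)
  qed
qed

lemma cocircuit_vectors_contraction_extend:
  assumes \<mu>: "valuated_matroid E r \<mu>" and S: "S \<subseteq> E"
    and v': "v' \<in> cocircuit_vectors (E - S) (r - matroid_rank E r \<mu> S) (contraction E r \<mu> S)"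
  obtains v a where "v \<in> cocircuit_vectors E r \<mu>"
    "\<forall>i\<in>E. v i = (if i \<in> S then \<infinity> else v' i + ereal a)"
proof -
  obtain A a where lift: "contraction_lift E r \<mu> S A a"
    using contraction_lift_exists[OF \<mu> S] .
  then have A: "A \<subseteq> S" "card A = matroid_rank E r \<mu> S"
    unfolding contraction_lift_def by blast+
  obtain K where K: "K \<subseteq> E - S" "card K + 1 = r - matroid_rank E r \<mu> S"
    and v'_eq: "v' = cocircuit_vector (E - S) (contraction E r \<mu> S) K"
    using v' unfolding cocircuit_vectors_def by blast
  have "card (A \<union> K) + 1 = r"
    using card_Un_subset_Diff[OF valuated_matroid_finite[OF \<mu>] S A(1) K(1)] A(2) K(2) by simp
  moreover have "A \<union> K \<subseteq> E"
    using A(1) K(1) S by blast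
  ultimately have "cocircuit_vector E \<mu> (A \<union> K) \<in> cocircuit_vectors E r \<mu>"
    unfolding cocircuit_vectors_def by blast
  then show thesis
    using that cocircuit_vector_Un_contraction_lift[OF \<mu> S lift K] v'_eq by blast
qed

lemma tropical_linear_space_of_contraction:
  assumes \<mu>: "valuated_matroid E r \<mu>" and S: "S \<subseteq> E"
    and w: "w \<in> tropical_vectors E" and infinite: "\<forall>i\<in>S. w i = \<infinity>"
    and restriction: "restrict w (E - S) \<in>
      tropical_linear_space (E - S) (r - matroid_rank E r \<mu> S) (contraction E r \<mu> S)"
  shows "w \<in> tropical_linear_space E r \<mu>"
proof -
  let ?q = "matroid_rank E r \<mu> S" and ?\<kappa> = "contraction E r \<mu> S"
  have "valuated_matroid (E - S) (r - ?q) ?\<kappa>"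
    using \<mu> S by (rule valuated_matroid_contraction)
  with restriction have restrict_in_span: "restrict w (E - S) \<in>
      tropical_span (E - S) (cocircuit_vectors (E - S) (r - ?q) ?\<kappa>)"
    using tropical_linear_space_subset_span_cocircuit_vectors by blast
  have "\<exists>v\<in>cocircuit_vectors E r \<mu>. \<exists>c. w e = v e + ereal c \<and> (\<forall>i\<in>E. w i \<le> v i + ereal c)"
    if e: "e \<in> E" "w e \<noteq> \<infinity>" for e
  proof -
    have "e \<in> E - S" "restrict w (E - S) e \<noteq> \<infinity>"
      using e infinite by auto
    with restrict_in_span obtain v' c
      where v': "v' \<in> cocircuit_vectors (E - S) (r - ?q) ?\<kappa>"
        and at_e: "w e = v' e + ereal c" and above: "\<forall>i\<in>E - S. w i \<le> v' i + ereal c"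
      by (elim tropical_spanE) auto
    obtain v a where v: "v \<in> cocircuit_vectors E r \<mu>"
      and v_eq: "\<forall>i\<in>E. v i = (if i \<in> S then \<infinity> else v' i + ereal a)"
      using cocircuit_vectors_contraction_extend[OF \<mu> S v'] .
    have "v i + ereal (c - a) = (if i \<in> S then \<infinity> else v' i + ereal c)" if "i \<in> E" for i
      using that v_eq by (simp add: add.assoc)
    then have "w e = v e + ereal (c - a)" "\<forall>i\<in>E. w i \<le> v i + ereal (c - a)"
      using at_e above \<open>e \<in> E - S\<close> by auto
    with v show ?thesis
      by blast
  qed
  then show ?thesis
    unfolding tropical_linear_space_eq_span_cocircuit_vectors[OF \<mu>] tropical_span_def
    using w by blast
qed

subsection \<open>Strata of tropical projective space\<close>

definition torus_class :: "'a set \<Rightarrow> ('a \<Rightarrow> real) \<Rightarrow> ('a \<Rightarrow> real) set" where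
  "torus_class E u = range (\<lambda>c. \<lambda>i\<in>E. u i + c)"

definition projective_class :: "'a set \<Rightarrow> ('a \<Rightarrow> ereal) \<Rightarrow> ('a \<Rightarrow> ereal) set" where
  "projective_class E w = range (\<lambda>c::real. \<lambda>i\<in>E. w i + ereal c)"

definition stratum_point :: "'a set \<Rightarrow> 'a set \<Rightarrow> ('a \<Rightarrow> real) \<Rightarrow> 'a \<Rightarrow> ereal" where
  "stratum_point E S u = (\<lambda>i\<in>E. if i \<in> S then \<infinity> else ereal (u i))"

lemma torus_class_self:
  assumes "u \<in> E \<rightarrow>\<^sub>E UNIV"
  shows "u \<in> torus_class E u"
proof -
  have "u = (\<lambda>i\<in>E. u i + 0)"
    using assms by (simp add: PiE_restrict)
  then show ?thesis
    unfolding torus_class_def by blast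
qed

lemma projective_class_self:
  assumes "w \<in> tropical_vectors E"
  shows "w \<in> projective_class E w"
proof -
  have "w = (\<lambda>i\<in>E. w i + ereal 0)"
    using assms by (auto simp: PiE_def extensional_def fun_eq_iff)
  then show ?thesis
    unfolding projective_class_def by blast
qed

lemma stratum_embedding_torus_class:
  "stratum_embedding E S (torus_class (E - S) u) = projective_class E (stratum_point E S u)"
proof -
  have "(\<lambda>i\<in>E. if i \<in> S then \<infinity> else ereal ((\<lambda>i\<in>E - S. u i + c) i)) =
      (\<lambda>i\<in>E. stratum_point E S u i + ereal c)" for c
    by (auto simp: stratum_point_def)
  then show ?thesis
    unfolding stratum_embedding_def torus_class_def projective_class_def image_image by simp
qed

lemma real_torus_eq: "real_torus E = torus_class E ` (E \<rightarrow>\<^sub>E UNIV)"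
proof -
  have "{(u, v). u \<in> E \<rightarrow>\<^sub>E UNIV \<and> (\<exists>c. v = (\<lambda>i\<in>E. u i + c))} `` {u} = torus_class E u"
    if "u \<in> E \<rightarrow>\<^sub>E UNIV" for u :: "'a \<Rightarrow> real"
    using that unfolding torus_class_def by blast
  then show ?thesis
    unfolding real_torus_def quotient_def by (simp add: UNION_singleton_eq_range)
qed

lemma Union_strata:
  "(\<Union>S\<in>{S. S \<subset> E}. stratum_point E S ` ((E - S) \<rightarrow>\<^sub>E UNIV)) = tropical_vectors E - {\<lambda>i\<in>E. \<infinity>}"
proof (intro set_eqI iffI)
  fix w assume "w \<in> (\<Union>S\<in>{S. S \<subset> E}. stratum_point E S ` ((E - S) \<rightarrow>\<^sub>E UNIV))"
  then obtain S u e where w: "w = stratum_point E S u" and "e \<in> E - S"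
    by blast
  then have "w e \<noteq> (\<lambda>i\<in>E. \<infinity>) e"
    by (simp add: stratum_point_def)
  then have "w \<noteq> (\<lambda>i\<in>E. \<infinity>)"
    by metis
  moreover have "w \<in> tropical_vectors E"
    by (auto simp: w stratum_point_def)
  ultimately show "w \<in> tropical_vectors E - {\<lambda>i\<in>E. \<infinity>}"
    by blast
next
  fix w assume w: "w \<in> tropical_vectors E - {\<lambda>i\<in>E. \<infinity>}"
  then have "w \<noteq> (\<lambda>i\<in>E. \<infinity>)" "w \<in> extensional E" and not_MInfty: "\<And>i. i \<in> E \<Longrightarrow> w i \<noteq> -\<infinity>"
    by (auto simp: PiE_def)
  define S where "S = {i \<in> E. w i = \<infinity>}"
  define u where "u = (\<lambda>i\<in>E - S. real_of_ereal (w i))"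
  have "w = stratum_point E S u"
  proof
    fix i show "w i = stratum_point E S u i"
      using \<open>w \<in> extensional E\<close> not_MInfty[of i]
      by (cases "w i") (auto simp: S_def u_def stratum_point_def extensional_def)
  qed
  moreover have "u \<in> (E - S) \<rightarrow>\<^sub>E UNIV"
    by (simp add: u_def)
  moreover have "\<not> (\<forall>i\<in>E. w i = \<infinity>)"
    using \<open>w \<noteq> (\<lambda>i\<in>E. \<infinity>)\<close> \<open>w \<in> extensional E\<close> by (metis extensional_restrict restrict_ext)
  then have "S \<subset> E"
    by (auto simp: S_def)
  ultimately show "w \<in> (\<Union>S\<in>{S. S \<subset> E}. stratum_point E S ` ((E - S) \<rightarrow>\<^sub>E UNIV))"
    by blast
qed

lemma stratum_point_in_tropical_linear_space_iff:
  assumes "valuated_matroid E r \<mu>" "S \<subseteq> E"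
  shows "stratum_point E S u \<in> tropical_linear_space E r \<mu> \<longleftrightarrow>
    (\<lambda>i\<in>E - S. ereal (u i)) \<in>
      tropical_linear_space (E - S) (r - matroid_rank E r \<mu> S) (contraction E r \<mu> S)"
proof -
  have restriction: "restrict (stratum_point E S u) (E - S) = (\<lambda>i\<in>E - S. ereal (u i))"
    and vector: "stratum_point E S u \<in> tropical_vectors E"
    and infinite: "\<forall>i\<in>S. stratum_point E S u i = \<infinity>"
    using assms(2) by (auto simp: stratum_point_def)
  show ?thesis
    unfolding restriction[symmetric]
  proof
    assume "stratum_point E S u \<in> tropical_linear_space E r \<mu>"
    then show "restrict (stratum_point E S u) (E - S) \<in>
        tropical_linear_space (E - S) (r - matroid_rank E r \<mu> S) (contraction E r \<mu> S)"
      using infinite by (rule restrict_in_tropical_linear_space_contraction[OF assms])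
  next
    assume "restrict (stratum_point E S u) (E - S) \<in>
        tropical_linear_space (E - S) (r - matroid_rank E r \<mu> S) (contraction E r \<mu> S)"
    with infinite show "stratum_point E S u \<in> tropical_linear_space E r \<mu>"
      by (rule tropical_linear_space_of_contraction[OF assms vector])
  qed
qed

lemma trop_eq:
  assumes "finite E"
  shows "trop E r \<mu> =
    torus_class E ` {u \<in> E \<rightarrow>\<^sub>E UNIV. (\<lambda>i\<in>E. ereal (u i)) \<in> tropical_linear_space E r \<mu>}"
proof -
  have "(\<forall>u'\<in>torus_class E u. (\<lambda>i\<in>E. ereal (u' i)) \<in> tropical_linear_space E r \<mu>) \<longleftrightarrow>
      (\<lambda>i\<in>E. ereal (u i)) \<in> tropical_linear_space E r \<mu>" if "u \<in> E \<rightarrow>\<^sub>E UNIV" for u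
  proof (intro iffI ballI)
    fix u' assume u: "(\<lambda>i\<in>E. ereal (u i)) \<in> tropical_linear_space E r \<mu>" and "u' \<in> torus_class E u"
    then obtain c where "u' = (\<lambda>i\<in>E. u i + c)"
      unfolding torus_class_def by blast
    then have "(\<lambda>i\<in>E. ereal (u' i)) = (\<lambda>i\<in>E. (\<lambda>i\<in>E. ereal (u i)) i + ereal c)"
      by auto
    then show "(\<lambda>i\<in>E. ereal (u' i)) \<in> tropical_linear_space E r \<mu>"
      using translate_in_tropical_linear_space[OF u] by simp
  qed (use torus_class_self[OF that] in blast)
  then show ?thesis
    unfolding trop_def real_torus_eq valuated_circuits_min_attained_twice_iff[OF assms] by blast
qed

lemma projective_trop_eq:
  assumes \<mu>: "valuated_matroid E r \<mu>"
  shows "projective_trop E r \<mu> =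
    projective_class E ` (tropical_linear_space E r \<mu> - {\<lambda>i\<in>E. \<infinity>})"
proof -
  let ?L = "tropical_linear_space E r \<mu>"
  have "stratum_embedding E S ` trop (E - S) (r - matroid_rank E r \<mu> S) (contraction E r \<mu> S) =
      projective_class E ` (stratum_point E S ` ((E - S) \<rightarrow>\<^sub>E UNIV) \<inter> ?L)" if "S \<subset> E" for S
  proof -
    have "stratum_embedding E S ` trop (E - S) (r - matroid_rank E r \<mu> S) (contraction E r \<mu> S) =
        projective_class E ` stratum_point E S ` {u \<in> (E - S) \<rightarrow>\<^sub>E UNIV. stratum_point E S u \<in> ?L}"
      using that stratum_point_in_tropical_linear_space_iff[OF \<mu>, of S]
        valuated_matroid_finite[OF \<mu>]
      by (simp add: trop_eq image_image stratum_embedding_torus_class psubset_imp_subset)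
    also have "stratum_point E S ` {u \<in> (E - S) \<rightarrow>\<^sub>E UNIV. stratum_point E S u \<in> ?L} =
        stratum_point E S ` ((E - S) \<rightarrow>\<^sub>E UNIV) \<inter> ?L"
      by blast
    finally show ?thesis .
  qed
  then have "projective_trop E r \<mu> =
      (\<Union>S\<in>{S. S \<subset> E}. projective_class E ` (stratum_point E S ` ((E - S) \<rightarrow>\<^sub>E UNIV) \<inter> ?L))"
    unfolding projective_trop_def by simp
  also have "\<dots> = projective_class E `
      ((\<Union>S\<in>{S. S \<subset> E}. stratum_point E S ` ((E - S) \<rightarrow>\<^sub>E UNIV)) \<inter> ?L)"
    by blast
  also have "\<dots> = projective_class E ` (?L - {\<lambda>i\<in>E. \<infinity>})"
    unfolding Union_strata tropical_linear_space_def by (rule arg_cong[of _ _ "image _"]) blast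
  finally show ?thesis .
qed

lemma projective_class_in_projective_trop_iff:
  assumes \<mu>: "valuated_matroid E r \<mu>" and w: "w \<in> tropical_vectors E" "w \<noteq> (\<lambda>i\<in>E. \<infinity>)"
  shows "projective_class E w \<in> projective_trop E r \<mu> \<longleftrightarrow> w \<in> tropical_linear_space E r \<mu>"
proof
  assume "projective_class E w \<in> projective_trop E r \<mu>"
  then obtain w' where w': "w' \<in> tropical_linear_space E r \<mu>"
    and "projective_class E w = projective_class E w'"
    unfolding projective_trop_eq[OF \<mu>] by blast
  with projective_class_self[OF w(1)] obtain c where "w = (\<lambda>i\<in>E. w' i + ereal c)"
    unfolding projective_class_def by blast
  then show "w \<in> tropical_linear_space E r \<mu>"
    using translate_in_tropical_linear_space[OF w'] by simp
next
  assume "w \<in> tropical_linear_space E r \<mu>"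
  then show "projective_class E w \<in> projective_trop E r \<mu>"
    unfolding projective_trop_eq[OF \<mu>] using w(2) by blast
qed

lemma projective_trop_subset_iff:
  assumes \<mu>: "valuated_matroid E r \<mu>" and \<nu>: "valuated_matroid E s \<nu>"
  shows "projective_trop E r \<mu> \<subseteq> projective_trop E s \<nu> \<longleftrightarrow>
    tropical_linear_space E r \<mu> \<subseteq> tropical_linear_space E s \<nu>"
proof
  assume subset: "projective_trop E r \<mu> \<subseteq> projective_trop E s \<nu>"
  show "tropical_linear_space E r \<mu> \<subseteq> tropical_linear_space E s \<nu>"
  proof
    fix w assume w: "w \<in> tropical_linear_space E r \<mu>"
    then have w_vector: "w \<in> tropical_vectors E"
      unfolding tropical_linear_space_def by blast
    show "w \<in> tropical_linear_space E s \<nu>"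
    proof (cases "w = (\<lambda>i\<in>E. \<infinity>)")
      case True
      then show ?thesis
        by (auto simp: tropical_linear_space_def tropically_vanishes_def)
    next
      case False
      then show ?thesis
        using w subset projective_class_in_projective_trop_iff[OF \<mu> w_vector]
          projective_class_in_projective_trop_iff[OF \<nu> w_vector] by blast
    qed
  qed
next
  assume "tropical_linear_space E r \<mu> \<subseteq> tropical_linear_space E s \<nu>"
  then show "projective_trop E r \<mu> \<subseteq> projective_trop E s \<nu>"
    unfolding projective_trop_eq[OF \<mu>] projective_trop_eq[OF \<nu>] by blast
qed

subsection \<open>Flags of projective tropical linear spaces\<close>

lemma valuated_quotient_iff_projective_trop_subset:
  assumes "valuated_matroid E r \<mu>" "valuated_matroid E s \<nu>"
  shows "valuated_quotient E r \<mu> s \<nu> \<longleftrightarrow> projective_trop E r \<mu> \<subseteq> projective_trop E s \<nu>"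
  using valuated_quotient_iff_tropical_linear_space_subset[OF assms(1)]
    projective_trop_subset_iff[OF assms] by blast

lemma valuated_flag_matroid_iff_projective_trop_chain:
  assumes \<mu>: "\<And>i. i \<in> {1..k} \<Longrightarrow> valuated_matroid E (r i) (\<mu> i)"
  shows "valuated_flag_matroid E k r \<mu> \<longleftrightarrow>
    (\<forall>i\<in>{1..<k}. projective_trop E (r i) (\<mu> i) \<subseteq> projective_trop E (r (Suc i)) (\<mu> (Suc i)))"
proof
  assume flag: "valuated_flag_matroid E k r \<mu>"
  show "\<forall>i\<in>{1..<k}. projective_trop E (r i) (\<mu> i) \<subseteq> projective_trop E (r (Suc i)) (\<mu> (Suc i))"
  proof
    fix i assume "i \<in> {1..<k}"
    then have "i \<in> {1..k}" "Suc i \<in> {1..k}"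
      by auto
    moreover from this have "valuated_quotient E (r i) (\<mu> i) (r (Suc i)) (\<mu> (Suc i))"
      using flag unfolding valuated_flag_matroid_def by blast
    ultimately show "projective_trop E (r i) (\<mu> i) \<subseteq> projective_trop E (r (Suc i)) (\<mu> (Suc i))"
      using valuated_quotient_iff_projective_trop_subset[OF \<mu> \<mu>] by blast
  qed
next
  assume chain: "\<forall>i\<in>{1..<k}. projective_trop E (r i) (\<mu> i)
    \<subseteq> projective_trop E (r (Suc i)) (\<mu> (Suc i))"
  have "r i \<le> r j \<and> valuated_quotient E (r i) (\<mu> i) (r j) (\<mu> j)"
    if ij: "i \<in> {1..k}" "j \<in> {1..k}" "i < j" for i j
  proof -
    have "projective_trop E (r i) (\<mu> i) \<subseteq> projective_trop E (r j) (\<mu> j)"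
      by (rule lift_Suc_mono_le_ivl[of "{1..<k}"]) (use ij chain in auto)
    then have "valuated_quotient E (r i) (\<mu> i) (r j) (\<mu> j)"
      using valuated_quotient_iff_projective_trop_subset[OF \<mu> \<mu>] ij by blast
    then show ?thesis
      using valuated_quotient_rank_le[OF \<mu> \<mu>] ij by blast
  qed
  then show "valuated_flag_matroid E k r \<mu>"
    unfolding valuated_flag_matroid_def using \<mu> by blast
qed

theorem theorem4p15:
  fixes n :: nat
  shows "(\<forall>r s \<mu> \<nu>.
            valuated_matroid {1..n} r \<mu> \<longrightarrow> valuated_matroid {1..n} s \<nu> \<longrightarrow> r \<le> s \<longrightarrow>
            (valuated_quotient {1..n} r \<mu> s \<nu> \<longleftrightarrow>
               projective_trop {1..n} r \<mu> \<subseteq> projective_trop {1..n} s \<nu>)) \<and>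
         (\<forall>k r \<mu>.
            (\<forall>i\<in>{1..k}. valuated_matroid {1..n} (r i) (\<mu> i)) \<longrightarrow>
            (valuated_flag_matroid {1..n} k r \<mu> \<longleftrightarrow>
               (\<forall>i\<in>{1..<k}. projective_trop {1..n} (r i) (\<mu> i)
                             \<subseteq> projective_trop {1..n} (r (Suc i)) (\<mu> (Suc i)))))"
  using valuated_quotient_iff_projective_trop_subset valuated_flag_matroid_iff_projective_trop_chain
  by blast

end
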